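(* Let $K$ be an algebraically closed field, let $E=(E_1,\ldots,E_n)$ be an $n$-tuple of nonempty finite subsets of $\mathbb{Z}^n$ with mixed volume $\mathcal{M}(E)>0$, let $F=(f_1,\ldots,f_n)$ be an $n\times n$ polynomial system over $K$ with support contained in $E$, and let $P:=\sum_{i=1}^n\mathrm{Conv}(E_i)$. Let $A\subset\mathbb{Z}^n$, with at least two elements, be the set of vertices of a product of simplices with which $P$ is compatible. Let $u=(u_e\mid e\in A)$ be algebraically independent indeterminates, $g(x):=\sum_{e\in A}u_ex^e$, and let $\mathrm{Ch}_A(u):=\mathrm{Res}_{(E,A)}(F,g)$ (called the twisted Chow form of the zero set of $F$ with respect to $A$). If $F$ has only finitely many roots in $\mathcal{T}_P$, then $\mathrm{Ch}_A(u)$ does not vanish identically.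
   Context: Polynomials are Laurent polynomials in $x=(x_1,\ldots,x_n)$ with multi-index notation $x^e=x_1^{e_1}\cdots x_n^{e_n}$; all roots are over the algebraically closed field $K$. "$F=(f_1,\ldots,f_n)$ has support contained in $E$" means each $f_i$ is a $K$-linear combination of the monomials $x^e$, $e\in E_i$. $\mathrm{Conv}$ denotes convex hull in $\mathbb{R}^n$; sums of polytopes are Minkowski sums. A product of simplices in $\mathbb{R}^n$ is a Minkowski sum of simplices lying in translates of linearly independent subspaces. Mixed volume: $\mathcal{M}(E)$ is the $n$-dimensional mixed volume of $\mathrm{Conv}(E_1),\ldots,\mathrm{Conv}(E_n)$, i.e. the coefficient of $\lambda_1\cdots\lambda_n$ in $\mathrm{Vol}_n(\sum_i\lambda_i\mathrm{Conv}(E_i))$ (so $n$ copies of the standard $n$-simplex have mixed volume $1$). Compatibility: a polytope $P$ is compatible with a polytope $Q$ iff every cone of the inner normal fan $\mathrm{Fan}(Q)$ is a union of cones of $\mathrm{Fan}(P)$. Toric (sparse) resultant: let $(E_1,\ldots,E_{n+1})$ be nonempty finite subsets of $\mathbb{Z}^n$ such that deleting some $E_i$ leaves an $n$-tuple of positive mixed volume. $\mathrm{Res}_{(E_1,\ldots,E_{n+1})}$ is the polynomial with integer coefficients in the indeterminate coefficients $c_{i,e}$ ($e\in E_i$) of generic polynomials $f_i=\sum_{e\in E_i}c_{i,e}x^e$, defined up to sign as the power of the primitive irreducible polynomial defining the Zariski closure of the set of complex coefficient vectors for which $f_1=\cdots=f_{n+1}=0$ has a solution in $(\mathbb{C}^*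 )^n$, the power being such that its degree in the coefficients of $f_i$ is $\mathcal{M}(E_1,\ldots,E_{i-1},E_{i+1},\ldots,E_{n+1})$ for every $i$. It is evaluated on polynomials with coefficients in $K$ or $K[u]$ via $\mathbb{Z}\to K$. $\mathrm{Res}_{(E,A)}$ denotes the case $(E_1,\ldots,E_n,A)$. Toric variety: for an $n$-dimensional rational polytope $P\subset\mathbb{R}^n$, $\mathcal{T}_P$ is the complete toric variety over $K$ associated with the inner normal fan $\mathrm{Fan}(P)$, containing the torus $(K^* )^n$ as a dense open subset. For $w\in\mathbb{R}^n$, $\sigma_w$ is the closure of the cone generated by the inner normals of the face $P^w$ of $P$ with inner normal $w$, $\sigma_w^\vee$ is its dual cone, and $U_w=\mathrm{Spec}\,K[x^e\mid e\in\sigma_w^\vee\cap\mathbb{Z}^n]$ is the corresponding affine chart. Roots of $F$ in $\mathcal{T}_P$: the points of the zero set $\bigcap_{i=1}^n\mathcal{D}_P(f_i,\mathrm{Conv}(E_i))$, where $\mathcal{D}_P(f,Q)=\mathrm{Div}(f)+\mathcal{E}_P(Q)$ is the effective divisor obtained by adding to the Weil divisor of the rational function $f$ the torus-invariant divisor $\mathcal{E}_P(Q)=\sum_w(-\min_{q\in Q}w\cdot q)\,V_w$, with $w$ ranging over the primitive inner facet normals of $P$ and $V_w$ the corresponding torus-invariant prime divisor. Equivalently, in each chart $U_w$ the zero set is defined by the ideal generated by all $x^bf_i$ with $i\in\{1,\ldots,n\}$, $b\in\mathbb{Z}^n$, $b+\mathrm{Conv}(E_i)\subset\sigma_w^\vee$.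 *)

theory Defs
  imports "HOL-Analysis.Analysis" "HOL-Library.Poly_Mapping" "HOL-Computational_Algebra.Polynomial"
begin

section \<open>Polynomials\<close>

text \<open>Polynomials in variables of type \<open>'v\<close> are finitely supported maps from exponents
  (themselves finitely supported) to coefficients; multiplication is convolution.
  A Laurent polynomial in \<open>n = CARD('n)\<close> variables has exponents in \<open>int ^ 'n\<close>.\<close>

type_synonym ('v, 'a) mpoly = "('v \<Rightarrow>\<^sub>0 nat) \<Rightarrow>\<^sub>0 'a"
type_synonym ('n, 'a) laurent = "(int ^ 'n) \<Rightarrow>\<^sub>0 'a"

abbreviation mcoeff :: "('m \<Rightarrow>\<^sub>0 'a::zero) \<Rightarrow> 'm \<Rightarrow> 'a"
  where "mcoeff \<equiv> Poly_Mapping.lookup"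

abbreviation msupport :: "('m \<Rightarrow>\<^sub>0 'a::zero) \<Rightarrow> 'm set"
  where "msupport \<equiv> Poly_Mapping.keys"

definition mpoly_vars :: "('v, 'a::zero) mpoly \<Rightarrow> 'v set"
  where "mpoly_vars p = (\<Union>m\<in>msupport p. msupport m)"

definition mpoly_const :: "'a::zero \<Rightarrow> ('v, 'a) mpoly"
  where "mpoly_const a = Poly_Mapping.single 0 a"

definition mpoly_var :: "'v \<Rightarrow> ('v, 'a::zero_neq_one) mpoly"
  where "mpoly_var v = Poly_Mapping.single (Poly_Mapping.single v 1) 1"

definition mpoly_eval ::
    "('a::zero \<Rightarrow> 'r::comm_semiring_1) \<Rightarrow> ('v \<Rightarrow> 'r) \<Rightarrow> ('v, 'a) mpoly \<Rightarrow> 'r"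
  where "mpoly_eval \<phi> x p =
    (\<Sum>m\<in>msupport p. \<phi> (mcoeff p m) * (\<Prod>v\<in>msupport m. x v ^ mcoeff m v))"

definition mpoly_degree_in :: "'v set \<Rightarrow> ('v, 'a::zero) mpoly \<Rightarrow> nat"
  where "mpoly_degree_in V p = Max ((\<lambda>m. \<Sum>v\<in>msupport m \<inter> V. mcoeff m v) ` msupport p)"

definition primitive_mpoly :: "('v, int) mpoly \<Rightarrow> bool"
  where "primitive_mpoly p \<longleftrightarrow> Gcd (mcoeff p ` msupport p) = 1"

section \<open>Newton polytopes and mixed volumes\<close>

definition real_vec :: "int ^ 'n \<Rightarrow> real ^ 'n"
  where "real_vec e = (\<chi> k. real_of_int (e $ k))"

definition Conv :: "(int ^ 'n) set \<Rightarrow> (real ^ 'n) set"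
  where "Conv S = convex hull (real_vec ` S)"

text \<open>The polytopes are \<open>Q i\<close> with \<open>i \<in> I\<close>. The definite description is proper: on tuples of
  nonnegative scalars the volume is a polynomial function (Minkowski), which determines the
  polynomial. Sums of sets are Minkowski sums.\<close>

definition mixed_volume :: "'i::finite set \<Rightarrow> ('i \<Rightarrow> (real ^ 'n) set) \<Rightarrow> real"
  where "mixed_volume I Q = (THE c. \<exists>p :: ('i, real) mpoly.
    (\<forall>t. (\<forall>i. 0 \<le> t i) \<longrightarrow>
       measure lebesgue (\<Sum>i\<in>I. (\<lambda>x. t i *\<^sub>R x) ` Q i) = mpoly_eval (\<lambda>a. a) t p) \<and>
    c = mcoeff p (\<Sum>i\<in>I. Poly_Mapping.single i 1))"

section \<open>Fans, compatibility and products of simplices\<close>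

definition face_in_direction :: "(real ^ 'n) set \<Rightarrow> real ^ 'n \<Rightarrow> (real ^ 'n) set"
  where "face_in_direction P w = {x \<in> P. \<forall>y\<in>P. w \<bullet> x \<le> w \<bullet> y}"

definition normal_cone_of_face :: "(real ^ 'n) set \<Rightarrow> real ^ 'n \<Rightarrow> (real ^ 'n) set"
  where "normal_cone_of_face P w =
    closure (convex_cone hull {w'. face_in_direction P w' = face_in_direction P w})"

definition Fan :: "(real ^ 'n) set \<Rightarrow> (real ^ 'n) set set"
  where "Fan P = range (normal_cone_of_face P)"

definition compatible_with :: "(real ^ 'n) set \<Rightarrow> (real ^ 'n) set \<Rightarrow> bool"
  where "compatible_with P Q \<longleftrightarrow> (\<forall>\<tau>\<in>Fan Q. \<exists>\<C>\<subseteq>Fan P. \<tau> = \<Union>\<C>)"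

definition independent_subspaces :: "nat \<Rightarrow> (nat \<Rightarrow> (real ^ 'n) set) \<Rightarrow> bool"
  where "independent_subspaces k L \<longleftrightarrow> (\<forall>j<k. subspace (L j)) \<and>
    (\<forall>x. (\<forall>j<k. x j \<in> L j) \<and> (\<Sum>j<k. x j) = 0 \<longrightarrow> (\<forall>j<k. x j = 0))"

definition product_of_simplices :: "(real ^ 'n) set \<Rightarrow> bool"
  where "product_of_simplices B \<longleftrightarrow> (\<exists>k L t S. independent_subspaces k L \<and>
    (\<forall>j<k. \<exists>d. int d simplex S j \<and> S j \<subseteq> (\<lambda>x. t j + x) ` L j) \<and> B = (\<Sum>j<k. S j))"

section \<open>Sparse resultants\<close>

text \<open>The index type \<open>'i\<close> has \<open>n + 1\<close> elements in the intended use. Coefficient vectors of systems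
  with supports \<open>E i\<close> are represented by functions vanishing at the pairs \<open>(i, e)\<close> with
  \<open>e \<notin> E i\<close>.\<close>

definition coeff_vectors :: "('i \<Rightarrow> (int ^ 'n) set) \<Rightarrow> ('i \<times> (int ^ 'n) \<Rightarrow> complex) set"
  where "coeff_vectors E = {c. \<forall>i e. e \<notin> E i \<longrightarrow> c (i, e) = 0}"

definition solvable_coeffs :: "('i \<Rightarrow> (int ^ 'n) set) \<Rightarrow> ('i \<times> (int ^ 'n) \<Rightarrow> complex) set"
  where "solvable_coeffs E = {c \<in> coeff_vectors E. \<exists>x :: complex ^ 'n. (\<forall>k. x $ k \<noteq> 0) \<and>
    (\<forall>i. (\<Sum>e\<in>E i. c (i, e) * (\<Prod>k\<in>UNIV. (x $ k) powi (e $ k))) = 0)}"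

definition zariski_closure_in :: "('v \<Rightarrow> complex) set \<Rightarrow> ('v \<Rightarrow> complex) set \<Rightarrow> ('v \<Rightarrow> complex) set"
  where "zariski_closure_in C Z = {c \<in> C. \<forall>q :: ('v, complex) mpoly.
    (\<forall>z\<in>Z. mpoly_eval (\<lambda>a. a) z q = 0) \<longrightarrow> mpoly_eval (\<lambda>a. a) c q = 0}"

text \<open>The resultant is only defined up to sign, hence a predicate. It is meant for nonempty finite
  \<open>E i\<close> such that the mixed volume is positive after deleting some \<open>E i\<close>.\<close>

definition is_sparse_resultant ::
    "('i::finite \<Rightarrow> (int ^ 'n) set) \<Rightarrow> ('i \<times> (int ^ 'n), int) mpoly \<Rightarrow> bool"
  where "is_sparse_resultant E R \<longleftrightarrow> (\<exists>p d.
    mpoly_vars p \<subseteq> (SIGMA i:UNIV. E i) \<and> irreducible p \<and> primitive_mpoly p \<and>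
    {c \<in> coeff_vectors E. mpoly_eval of_int c p = 0}
      = zariski_closure_in (coeff_vectors E) (solvable_coeffs E) \<and>
    (R = p ^ d \<or> R = - (p ^ d)) \<and>
    (\<forall>i. real (mpoly_degree_in ({i} \<times> UNIV) R) = mixed_volume (UNIV - {i}) (\<lambda>j. Conv (E j))))"

definition resultant_at ::
    "('i \<times> (int ^ 'n), int) mpoly \<Rightarrow> ('i \<Rightarrow> ('n, 'r::comm_ring_1) laurent) \<Rightarrow> 'r"
  where "resultant_at R G = mpoly_eval of_int (\<lambda>(i, e). mcoeff (G i) e) R"

text \<open>An \<open>(n + 1)\<close>-tuple \<open>(X\<^sub>1, \<dots>, X\<^sub>n, Y)\<close> is indexed by \<open>'n option\<close>, the last entry having
  index \<open>None\<close>.\<close>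

definition append_entry :: "('n \<Rightarrow> 'b) \<Rightarrow> 'b \<Rightarrow> 'n option \<Rightarrow> 'b"
  where "append_entry X Y i = (case i of None \<Rightarrow> Y | Some j \<Rightarrow> X j)"

definition generic_laurent :: "(int ^ 'n) set \<Rightarrow> ('n, (int ^ 'n, 'k::comm_ring_1) mpoly) laurent"
  where "generic_laurent A = (\<Sum>e\<in>A. Poly_Mapping.single e (mpoly_var e))"

text \<open>Here \<open>R\<close> is a resultant for the supports \<open>(E\<^sub>1, \<dots>, E\<^sub>n, A)\<close>; the result is a polynomial
  over \<open>'k\<close> in variables \<open>u\<^sub>e\<close> indexed by \<open>e \<in> A\<close>.\<close>

definition twisted_chow_form ::
    "('n option \<times> (int ^ 'n), int) mpoly \<Rightarrow> ('n \<Rightarrow> ('n, 'k::comm_ring_1) laurent) \<Rightarrow>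
      (int ^ 'n) set \<Rightarrow> (int ^ 'n, 'k) mpoly"
  where "twisted_chow_form R F A =
    resultant_at R (append_entry (\<lambda>i. Poly_Mapping.map mpoly_const (F i)) (generic_laurent A))"

section \<open>Toric varieties and roots\<close>

definition dual_cone :: "(real ^ 'n) set \<Rightarrow> (real ^ 'n) set"
  where "dual_cone \<sigma> = {v. \<forall>w\<in>\<sigma>. 0 \<le> w \<bullet> v}"

definition dual_monoid :: "(real ^ 'n) set \<Rightarrow> (int ^ 'n) set"
  where "dual_monoid \<sigma> = {a. real_vec a \<in> dual_cone \<sigma>}"

text \<open>The \<open>K\<close>-points of \<open>Spec K[S]\<close> for \<open>S = dual_monoid \<sigma>\<close>, that is, the \<open>K\<close>-algebra
  homomorphisms \<open>K[S] \<rightarrow> K\<close>, given by their restrictions to monomials: the monoid homomorphisms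
  \<open>S \<rightarrow> (K, \<cdot>)\<close>, extended by \<open>0\<close> outside \<open>S\<close> so that each has a single representative.\<close>

definition chart_points :: "(real ^ 'n) set \<Rightarrow> (int ^ 'n \<Rightarrow> 'k::field) set"
  where "chart_points \<sigma> = {\<gamma>. \<gamma> 0 = 1 \<and>
    (\<forall>a\<in>dual_monoid \<sigma>. \<forall>b\<in>dual_monoid \<sigma>. \<gamma> (a + b) = \<gamma> a * \<gamma> b) \<and>
    (\<forall>a. a \<notin> dual_monoid \<sigma> \<longrightarrow> \<gamma> a = 0)}"

definition restrict_point :: "(real ^ 'n) set \<Rightarrow> (int ^ 'n \<Rightarrow> 'k::field) \<Rightarrow> int ^ 'n \<Rightarrow> 'k"
  where "restrict_point \<sigma> \<delta> = (\<lambda>a. if a \<in> dual_monoid \<sigma> then \<delta> a else 0)"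

text \<open>The charts of \<open>\<sigma>\<close> and \<open>\<sigma>'\<close> are glued along the chart of the common face \<open>\<sigma> \<inter> \<sigma>'\<close>, whose
  inclusions are dual to those of \<open>dual_monoid \<sigma>\<close> and \<open>dual_monoid \<sigma>'\<close> in
  \<open>dual_monoid (\<sigma> \<inter> \<sigma>')\<close>.\<close>

definition toric_gluing ::
    "(real ^ 'n) set \<Rightarrow> ((real ^ 'n) set \<times> (int ^ 'n \<Rightarrow> 'k::field)) rel"
  where "toric_gluing P = {((\<sigma>, \<gamma>), (\<sigma>', \<gamma>')). \<sigma> \<in> Fan P \<and> \<sigma>' \<in> Fan P \<and>
    (\<exists>\<delta>\<in>chart_points (\<sigma> \<inter> \<sigma>'). \<gamma> = restrict_point \<sigma> \<delta> \<and> \<gamma>' = restrict_point \<sigma>' \<delta>)}"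

definition toric_variety ::
    "(real ^ 'n) set \<Rightarrow> ((real ^ 'n) set \<times> (int ^ 'n \<Rightarrow> 'k::field)) set set"
  where "toric_variety P = (SIGMA \<sigma>:Fan P. chart_points \<sigma>) // toric_gluing P"

text \<open>Vanishing at the chart point \<open>\<gamma>\<close> of all \<open>x\<^sup>b f\<^sub>i\<close> with \<open>b + Conv (E i) \<subseteq> dual_cone \<sigma>\<close>.\<close>

definition chart_root ::
    "('n \<Rightarrow> (int ^ 'n) set) \<Rightarrow> ('n \<Rightarrow> ('n, 'k::field) laurent) \<Rightarrow>
      (real ^ 'n) set \<Rightarrow> (int ^ 'n \<Rightarrow> 'k) \<Rightarrow> bool"
  where "chart_root E F \<sigma> \<gamma> \<longleftrightarrow>
    (\<forall>i b. (\<lambda>q. real_vec b + q) ` Conv (E i) \<subseteq> dual_cone \<sigma> \<longrightarrow>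
       (\<Sum>e\<in>msupport (F i). mcoeff (F i) e * \<gamma> (b + e)) = 0)"

definition toric_roots ::
    "(real ^ 'n) set \<Rightarrow> ('n \<Rightarrow> (int ^ 'n) set) \<Rightarrow> ('n \<Rightarrow> ('n, 'k::field) laurent) \<Rightarrow>
      ((real ^ 'n) set \<times> (int ^ 'n \<Rightarrow> 'k)) set set"
  where "toric_roots P E F = {X \<in> toric_variety P. \<exists>(\<sigma>, \<gamma>)\<in>X. chart_root E F \<sigma> \<gamma>}"

end

theory Submission
  imports Defs "HOL-Computational_Algebra.Fundamental_Theorem_Algebra"
    "HOL-Computational_Algebra.Fraction_Field"
begin

text \<open>Suppose that the twisted Chow form vanishes identically. Specialize \<open>u\<close> so that \<open>g\<close> vanishes at
  none of the finitely many roots of \<open>F\<close>; this is possible since \<open>P\<close> is compatible with the product of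
  simplices, so that in each chart some vertex of \<open>A\<close> divides all the others. Then the coefficient
  vector \<open>c\<close> of \<open>(F, g)\<close> is a zero over \<open>K\<close> of the primitive polynomial \<open>p\<close> underlying the resultant.
  By Gauss' lemma and a Nullstellensatz for hypersurfaces, every integer polynomial that vanishes on
  all solvable complex systems vanishes at \<open>c\<close>, whatever the characteristic of \<open>K\<close>. Hence the
  coefficients of a generic solvable system specialize to \<open>c\<close>, and by Chevalley's theorem this
  specialization extends to a place with values in \<open>K\<close>. The generic root lies in the torus over a
  field; as \<open>\<T>\<^sub>P\<close> is complete, the place sends it to a point of \<open>\<T>\<^sub>P\<close>, which is a common root of
  \<open>F\<close> and \<open>g\<close>, a contradiction.\<close>

section \<open>Ring homomorphisms and evaluation of polynomials\<close>

text \<open>The resultant is characterized by complex systems, while \<open>c\<close> has entries in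
  \<open>K\<close>, possibly of positive characteristic; only integer relations can be compared.
  Therefore the generic system lives in a fraction field over the integers. Primitivity matters for
  the same reason: the complex Nullstellensatz yields divisibility by \<open>p\<close> only up to an
  integer factor, which could vanish in \<open>K\<close>. A generic solvable system can be written
  down without elimination theory, since the equations are linear in the coefficients: the root and
  all coefficients but one per equation are free. A place is used because a specialization may send
  coordinates of the generic root to 0 or to infinity, so that the limit need not lie in the torus
  and has to be found in a chart. Homomorphisms on subrings are encoded by their graphs, so that
  extensions and unions of chains are those of sets.\<close>

locale ring_hom_fun =
  fixes h :: "'a::comm_ring_1 \<Rightarrow> 'b::comm_ring_1"
  assumes one: "h 1 = 1"
    and add: "h (a + b) = h a + h b"
    and mult: "h (a * b) = h a * h b"
begin

lemma zero: "h 0 = 0"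
  using add[of 0 0] by simp

lemma uminus: "h (- a) = - h a"
  using add[of a "- a"] zero by (simp add: eq_neg_iff_add_eq_0 add.commute)

lemma diff: "h (a - b) = h a - h b"
  using add[of a "- b"] uminus by simp

lemma sum: "h (sum f S) = (\<Sum>s\<in>S. h (f s))"
  by (induction S rule: infinite_finite_induct) (simp_all add: zero add)

lemma prod: "h (prod f S) = (\<Prod>s\<in>S. h (f s))"
  by (induction S rule: infinite_finite_induct) (simp_all add: one mult)

lemma power: "h (a ^ k) = h a ^ k"
  by (induction k) (simp_all add: one mult)

lemma of_nat: "h (of_nat k) = of_nat k"
  by (induction k) (simp_all add: one add zero)

lemma of_int: "h (of_int k) = of_int k"
  by (cases k rule: int_cases2) (simp_all add: of_nat uminus)

end

lemma ring_hom_fun_id: "ring_hom_fun (\<lambda>a. a)"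
  by unfold_locales auto

lemma ring_hom_fun_of_int: "ring_hom_fun of_int"
  by unfold_locales auto

lemma ring_hom_fun_poly: "ring_hom_fun (\<lambda>p. poly p a)"
  by unfold_locales auto

lemma ring_hom_fun_map_poly:
  assumes "ring_hom_fun h"
  shows "ring_hom_fun (map_poly h)"
proof -
  interpret ring_hom_fun h by fact
  show ?thesis
    by unfold_locales
      (auto simp: poly_eq_iff coeff_map_poly zero one add mult sum coeff_mult coeff_1)
qed

section \<open>Evaluation of multivariate polynomials as a ring homomorphism\<close>

definition mpoly_monom :: "('v \<Rightarrow> 'r::comm_semiring_1) \<Rightarrow> ('v \<Rightarrow>\<^sub>0 nat) \<Rightarrow> 'r"
  where "mpoly_monom x m = (\<Prod>v\<in>msupport m. x v ^ mcoeff m v)"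

lemma mpoly_monom_superset:
  assumes "finite V" "msupport m \<subseteq> V"
  shows "mpoly_monom x m = (\<Prod>v\<in>V. x v ^ mcoeff m v)"
  unfolding mpoly_monom_def using assms
  by (intro prod.mono_neutral_left) (auto simp: in_keys_iff)

lemma mpoly_monom_0 [simp]: "mpoly_monom x 0 = 1"
  by (simp add: mpoly_monom_def)

lemma mpoly_monom_add: "mpoly_monom x (m + m') = mpoly_monom x m * mpoly_monom x m'"
proof -
  let ?V = "msupport m \<union> msupport m'"
  have "msupport (m + m') \<subseteq> ?V" by (rule keys_add)
  then show ?thesis
    by (simp add: mpoly_monom_superset[of ?V] lookup_add power_add prod.distrib)
qed

lemma mpoly_eval_eq: "mpoly_eval \<phi> x p = (\<Sum>m\<in>msupport p. \<phi> (mcoeff p m) * mpoly_monom x m)"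
  by (simp add: mpoly_eval_def mpoly_monom_def)

lemma mpoly_eval_superset:
  assumes "\<phi> 0 = 0" "finite M" "msupport p \<subseteq> M"
  shows "mpoly_eval \<phi> x p = (\<Sum>m\<in>M. \<phi> (mcoeff p m) * mpoly_monom x m)"
  unfolding mpoly_eval_eq using assms
  by (intro sum.mono_neutral_left) (auto simp: in_keys_iff)

lemma mpoly_eval_single:
  assumes "\<phi> 0 = 0"
  shows "mpoly_eval \<phi> x (Poly_Mapping.single m a) = \<phi> a * mpoly_monom x m"
  using mpoly_eval_superset[of \<phi> "{m}" "Poly_Mapping.single m a" x] assms by simp

lemma mpoly_sum_single: "p = (\<Sum>m\<in>msupport p. Poly_Mapping.single m (mcoeff p m))"
  by (rule poly_mapping_eqI)
    (auto simp: lookup_sum lookup_single when_def in_keys_iff)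

lemma ring_hom_fun_mpoly_eval:
  fixes \<phi> :: "'a::comm_ring_1 \<Rightarrow> 'r::comm_ring_1"
  assumes "ring_hom_fun \<phi>"
  shows "ring_hom_fun (mpoly_eval \<phi> x)"
proof -
  interpret ring_hom_fun \<phi> by fact
  have ev_add: "mpoly_eval \<phi> x (p + q) = mpoly_eval \<phi> x p + mpoly_eval \<phi> x q" for p q
  proof -
    let ?M = "msupport p \<union> msupport q"
    have "msupport (p + q) \<subseteq> ?M" by (rule keys_add)
    then show ?thesis
      by (simp add: mpoly_eval_superset[of \<phi> ?M] zero lookup_add add distrib_right sum.distrib)
  qed
  have ev0: "mpoly_eval \<phi> x 0 = 0"
    by (simp add: mpoly_eval_def)
  have ev_sum: "mpoly_eval \<phi> x (sum f S) = (\<Sum>s\<in>S. mpoly_eval \<phi> x (f s))"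
    for f :: "('b \<Rightarrow>\<^sub>0 nat) \<Rightarrow> ('b, 'a) mpoly" and S
    by (induction S rule: infinite_finite_induct) (simp_all add: ev0 ev_add)
  have "mpoly_eval \<phi> x (p * q) = mpoly_eval \<phi> x p * mpoly_eval \<phi> x q" for p q
  proof -
    have "p * q = (\<Sum>m\<in>msupport p. \<Sum>m'\<in>msupport q.
        Poly_Mapping.single (m + m') (mcoeff p m * mcoeff q m'))"
      using arg_cong2[of _ _ _ _ "(*)", OF mpoly_sum_single[of p] mpoly_sum_single[of q]]
      by (simp add: sum_product mult_single)
    then show ?thesis
      by (simp add: ev_sum mpoly_eval_single zero mult mpoly_monom_add)
        (simp add: mpoly_eval_eq sum_product mult.assoc mult.left_commute)
  qed
  moreover have "mpoly_eval \<phi> x 1 = 1"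
    using mpoly_eval_single[of \<phi> x 0 1] by (simp add: zero one)
  ultimately show ?thesis
    by unfold_locales (simp_all add: ev_add)
qed

interpretation ev_int: ring_hom_fun "mpoly_eval of_int x"
  for x :: "'v \<Rightarrow> 'r::comm_ring_1"
  by (rule ring_hom_fun_mpoly_eval[OF ring_hom_fun_of_int])

lemma mpoly_eval_var:
  assumes "\<phi> 0 = 0" "\<phi> 1 = 1"
  shows "mpoly_eval \<phi> x (mpoly_var v) = x v"
  by (simp add: mpoly_var_def mpoly_eval_single assms mpoly_monom_def)

lemma mpoly_eval_const:
  assumes "\<phi> 0 = 0"
  shows "mpoly_eval \<phi> x (mpoly_const a) = \<phi> a"
  by (simp add: mpoly_const_def mpoly_eval_single assms)

lemma (in ring_hom_fun) mpoly_eval_hom: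
  "h (mpoly_eval \<phi> x p) = mpoly_eval (\<lambda>a. h (\<phi> a)) (\<lambda>v. h (x v)) p"
  by (simp add: mpoly_eval_def sum mult prod power)

lemma (in ring_hom_fun) mpoly_eval_int_hom:
  "h (mpoly_eval of_int x p) = mpoly_eval of_int (\<lambda>v. h (x v)) p"
  by (simp add: mpoly_eval_hom of_int)

lemma mpoly_eval_cong:
  assumes "\<And>v. v \<in> mpoly_vars p \<Longrightarrow> x v = y v"
  shows "mpoly_eval \<phi> x p = mpoly_eval \<phi> y p"
proof -
  have "x v ^ mcoeff m v = y v ^ mcoeff m v" if "m \<in> msupport p" "v \<in> msupport m" for m v
  proof -
    have "v \<in> mpoly_vars p" using that by (auto simp: mpoly_vars_def)
    then show ?thesis by (simp add: assms)
  qed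
  then show ?thesis
    unfolding mpoly_eval_def by simp
qed

text \<open>The variables form the tautological point; this identifies the value at \<open>0\<close>
  of the translated polynomial below.\<close>

lemma mpoly_eval_var_id:
  fixes p :: "('v, int) mpoly"
  shows "mpoly_eval of_int mpoly_var p = p"
proof -
  have mon: "mpoly_monom mpoly_var m = (Poly_Mapping.single m 1 :: ('v, int) mpoly)" for m :: "'v \<Rightarrow>\<^sub>0 nat"
  proof -
    have pow: "(mpoly_var v :: ('v, int) mpoly) ^ k = Poly_Mapping.single (Poly_Mapping.single v k) 1"
      for v :: 'v and k
      by (induction k) (simp_all add: mpoly_var_def mult_single single_add[symmetric])
    have "(\<Prod>v\<in>S. Poly_Mapping.single (Poly_Mapping.single v (k v)) 1)
        = (Poly_Mapping.single (\<Sum>v\<in>S. Poly_Mapping.single v (k v)) 1 :: ('v, int) mpoly)"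
      for S :: "'v set" and k :: "'v \<Rightarrow> nat"
      by (induction S rule: infinite_finite_induct) (simp_all add: mult_single)
    then have "mpoly_monom mpoly_var m = (Poly_Mapping.single
        (\<Sum>v\<in>msupport m. Poly_Mapping.single v (mcoeff m v)) 1 :: ('v, int) mpoly)"
      by (simp add: mpoly_monom_def pow)
    moreover have "(\<Sum>v\<in>msupport m. Poly_Mapping.single v (mcoeff m v)) = m"
      by (rule poly_mapping_eqI) (auto simp: lookup_sum lookup_single when_def in_keys_iff)
    ultimately show ?thesis by simp
  qed
  have "of_int a * Poly_Mapping.single m 1 = (Poly_Mapping.single m a :: ('v, int) mpoly)" for a m
  proof -
    have "of_int a = (Poly_Mapping.single 0 a :: ('v, int) mpoly)"
      using single_of_int[of a, where ?'a = "'v \<Rightarrow>\<^sub>0 nat" and ?'b = int] by simp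
    then show ?thesis by (simp add: mult_single)
  qed
  then show ?thesis
    using mpoly_sum_single[of p] by (simp add: mpoly_eval_eq mon)
qed

section \<open>Extension of partial homomorphisms between fields\<close>

text \<open>A homomorphism from a subring of a field into another field, given by its graph.\<close>

definition partial_hom :: "('a::field \<times> 'b::field) set \<Rightarrow> bool"
  where "partial_hom G \<longleftrightarrow> (1, 1) \<in> G \<and>
    (\<forall>a b c d. (a, b) \<in> G \<longrightarrow> (c, d) \<in> G \<longrightarrow> (a - c, b - d) \<in> G \<and> (a * c, b * d) \<in> G) \<and>
    (\<forall>b. (0, b) \<in> G \<longrightarrow> b = 0)"

lemma partial_homI:
  assumes "(1, 1) \<in> G"
    and "\<And>a b c d. (a, b) \<in> G \<Longrightarrow> (c, d) \<in> G \<Longrightarrow> (a - c, b - d) \<in> G"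
    and "\<And>a b c d. (a, b) \<in> G \<Longrightarrow> (c, d) \<in> G \<Longrightarrow> (a * c, b * d) \<in> G"
    and "\<And>b. (0, b) \<in> G \<Longrightarrow> b = 0"
  shows "partial_hom G"
  using assms unfolding partial_hom_def by blast

context
  fixes G :: "('a::field \<times> 'b::field) set"
  assumes G: "partial_hom G"
begin

lemma partial_hom_one: "(1, 1) \<in> G"
  using G by (simp add: partial_hom_def)

lemma partial_hom_diff: "(a, b) \<in> G \<Longrightarrow> (c, d) \<in> G \<Longrightarrow> (a - c, b - d) \<in> G"
  using G by (simp add: partial_hom_def)

lemma partial_hom_mult: "(a, b) \<in> G \<Longrightarrow> (c, d) \<in> G \<Longrightarrow> (a * c, b * d) \<in> G"
  using G by (simp add: partial_hom_def)

lemma partial_hom_single_valued: "(a, b) \<in> G \<Longrightarrow> (a, c) \<in> G \<Longrightarrow> b = c"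
  using partial_hom_diff[of a b a c] G by (auto simp: partial_hom_def)

lemma partial_hom_zero: "(0, 0) \<in> G"
  using partial_hom_diff[OF partial_hom_one partial_hom_one] by simp

lemma partial_hom_uminus: "(a, b) \<in> G \<Longrightarrow> (- a, - b) \<in> G"
  using partial_hom_diff[OF partial_hom_zero] by fastforce

lemma partial_hom_add: "(a, b) \<in> G \<Longrightarrow> (c, d) \<in> G \<Longrightarrow> (a + c, b + d) \<in> G"
  using partial_hom_diff[OF _ partial_hom_uminus, of a b c d] by simp

lemma partial_hom_sum: "(\<And>s. s \<in> S \<Longrightarrow> (f s, g s) \<in> G) \<Longrightarrow> (sum f S, sum g S) \<in> G"
  by (induction S rule: infinite_finite_induct) (simp_all add: partial_hom_zero partial_hom_add)

lemma partial_hom_prod: "(\<And>s. s \<in> S \<Longrightarrow> (f s, g s) \<in> G) \<Longrightarrow> (prod f S, prod g S) \<in> G"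
  by (induction S rule: infinite_finite_induct) (simp_all add: partial_hom_one partial_hom_mult)

lemma partial_hom_power: "(a, b) \<in> G \<Longrightarrow> (a ^ k, b ^ k) \<in> G"
  by (induction k) (simp_all add: partial_hom_one partial_hom_mult)

lemma partial_hom_of_nat: "(of_nat k, of_nat k) \<in> G"
  by (induction k) (auto intro: partial_hom_zero partial_hom_add partial_hom_one)

lemma partial_hom_of_int: "(of_int k, of_int k) \<in> G"
  by (cases k rule: int_cases2) (auto intro: partial_hom_of_nat partial_hom_uminus)

lemma partial_hom_mpoly_eval:
  "(\<And>v. (x v, y v) \<in> G) \<Longrightarrow> (mpoly_eval of_int x p, mpoly_eval of_int y p) \<in> G"
  unfolding mpoly_eval_def
  by (intro partial_hom_sum partial_hom_mult partial_hom_prod partial_hom_power partial_hom_of_int)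

end

text \<open>With \<open>G\<close> the graph of a homomorphism on a subring, this is the graph of the
  induced map on polynomials over that subring.\<close>

definition coeff_pairs :: "('a::field \<times> 'b::field) set \<Rightarrow> ('a poly \<times> 'b poly) set"
  where "coeff_pairs G = {(f, g). \<forall>i. (coeff f i, coeff g i) \<in> G}"

context
  fixes G :: "('a::field \<times> 'b::field) set"
  assumes G: "partial_hom G"
begin

lemma coeff_pairs_diff:
  "(f, g) \<in> coeff_pairs G \<Longrightarrow> (f', g') \<in> coeff_pairs G \<Longrightarrow> (f - f', g - g') \<in> coeff_pairs G"
  by (simp add: coeff_pairs_def partial_hom_diff[OF G])

lemma coeff_pairs_mult:
  "(f, g) \<in> coeff_pairs G \<Longrightarrow> (f', g') \<in> coeff_pairs G \<Longrightarrow> (f * f', g * g') \<in> coeff_pairs G"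
  by (simp add: coeff_pairs_def coeff_mult partial_hom_mult[OF G] partial_hom_sum[OF G])

lemma coeff_pairs_monom: "(a, b) \<in> G \<Longrightarrow> (monom a k, monom b k) \<in> coeff_pairs G"
  by (simp add: coeff_pairs_def partial_hom_zero[OF G])

text \<open>The extension sends the value of \<open>f\<close> at \<open>x\<close> to the value of
  its image \<open>g\<close> at \<open>\<alpha>\<close>. It is well defined because relations of
  \<open>x\<close> become relations of \<open>\<alpha>\<close>.\<close>

lemma partial_hom_adjoin:
  assumes "\<And>f g. (f, g) \<in> coeff_pairs G \<Longrightarrow> poly f x = 0 \<Longrightarrow> poly g \<alpha> = 0"
  shows "\<exists>H. G \<subseteq> H \<and> (x, \<alpha>) \<in> H \<and> partial_hom H"
proof -
  let ?H = "{(poly f x, poly g \<alpha>) | f g. (f, g) \<in> coeff_pairs G}"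
  have "(a, b) \<in> ?H" if "(a, b) \<in> G" for a b
    using coeff_pairs_monom[OF that, of 0] by (force simp: poly_monom)
  moreover have "(x, \<alpha>) \<in> ?H"
    using coeff_pairs_monom[OF partial_hom_one[OF G], of 1] by (force simp: poly_monom)
  moreover have "partial_hom ?H"
  proof (rule partial_homI)
    show "(1, 1) \<in> ?H"
      using coeff_pairs_monom[OF partial_hom_one[OF G], of 0] by (force simp: poly_monom)
    fix a b c d assume "(a, b) \<in> ?H" "(c, d) \<in> ?H"
    then obtain f g f' g' where *: "(f, g) \<in> coeff_pairs G" "(f', g') \<in> coeff_pairs G"
      and [simp]: "a = poly f x" "b = poly g \<alpha>" "c = poly f' x" "d = poly g' \<alpha>" by blast
    show "(a - c, b - d) \<in> ?H"
      using coeff_pairs_diff[OF *] by (force simp flip: poly_diff)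
    show "(a * c, b * d) \<in> ?H"
      using coeff_pairs_mult[OF *] by (force simp flip: poly_mult)
  next
    fix b assume "(0, b) \<in> ?H"
    then obtain f g where "(f, g) \<in> coeff_pairs G" "poly f x = 0" "b = poly g \<alpha>" by force
    then show "b = 0" using assms by blast
  qed
  ultimately show ?thesis by (intro exI[of _ ?H]) auto
qed

end

section \<open>Maximal homomorphisms and places\<close>

lemma poly_sum_bound:
  fixes f :: "'a::comm_semiring_1 poly"
  assumes "degree f \<le> n"
  shows "poly f x = (\<Sum>i\<le>n. coeff f i * x ^ i)"
  unfolding poly_altdef using assms
  by (intro sum.mono_neutral_left) (auto simp: coeff_eq_0)

context
  fixes G :: "('a::field \<times> 'b::field) set"
  assumes G: "partial_hom G"
    and maximal: "\<And>H. G \<subseteq> H \<Longrightarrow> partial_hom H \<Longrightarrow> H = G"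
begin

text \<open>Multiplied by \<open>a ^ n\<close>, a relation of \<open>inverse a\<close> becomes a
  relation inside the domain, and its image is a relation of \<open>inverse b\<close>. So
  \<open>inverse a\<close> can be adjoined; the domain is a local ring.\<close>

lemma maximal_partial_hom_inverse:
  assumes ab: "(a, b) \<in> G" and "b \<noteq> 0"
  shows "(inverse a, inverse b) \<in> G"
proof -
  have "a \<noteq> 0" using G ab \<open>b \<noteq> 0\<close> by (auto simp: partial_hom_def)
  have "poly g (inverse b) = 0"
    if fg: "(f, g) \<in> coeff_pairs G" and 0: "poly f (inverse a) = 0" for f g
  proof -
    define n where "n = max (degree f) (degree g)"
    have clear: "y ^ n * poly h (inverse y) = (\<Sum>i\<le>n. coeff h i * y ^ (n - i))"
      if "y \<noteq> 0" "degree h \<le> n" for y :: "'c::field" and h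
      unfolding poly_sum_bound[OF that(2)] sum_distrib_left
      using that(1) by (intro sum.cong) (auto simp: power_diff field_simps)
    have "(\<Sum>i\<le>n. coeff f i * a ^ (n - i), \<Sum>i\<le>n. coeff g i * b ^ (n - i)) \<in> G"
      using fg by (intro partial_hom_sum[OF G] partial_hom_mult[OF G] partial_hom_power[OF G] ab)
        (auto simp: coeff_pairs_def)
    then have "(0, b ^ n * poly g (inverse b)) \<in> G"
      using clear[of a f] clear[of b g] \<open>a \<noteq> 0\<close> \<open>b \<noteq> 0\<close> 0 by (simp add: n_def)
    then show ?thesis using G \<open>b \<noteq> 0\<close> by (auto simp: partial_hom_def)
  qed
  then have "\<exists>H. G \<subseteq> H \<and> (inverse a, inverse b) \<in> H \<and> partial_hom H"
    by (intro partial_hom_adjoin[OF G])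
  then obtain H where "G \<subseteq> H" "(inverse a, inverse b) \<in> H" "partial_hom H" by blast
  then show ?thesis using maximal[of H] by simp
qed

text \<open>Chevalley's argument: with m the kernel of \<open>G\<close>, 1 cannot lie in both m[x]
  and m[1/x]. The relation of smaller or equal degree rewrites the leading term of the other by
  lower terms, so the sum of the degrees drops.\<close>

lemma maximal_partial_hom_not_both:
  assumes "x \<noteq> 0"
    and "\<And>i. (coeff f i, 0) \<in> G" "poly f x = 1"
    and "\<And>i. (coeff g i, 0) \<in> G" "poly g (inverse x) = 1"
  shows False
  using assms
proof (induction "degree f + degree g" arbitrary: f g x rule: less_induct)
  case less
  have reduce: "\<exists>f'. (\<forall>i. (coeff f' i, 0) \<in> G) \<and> poly f' x = 1 \<and> degree f' < degree f"
    if x: "x \<noteq> 0" and f: "\<And>i. (coeff f i, 0) \<in> G" "poly f x = 1"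
      and g: "\<And>i. (coeff g i, 0) \<in> G" "poly g (inverse x) = 1"
      and deg: "degree g \<le> degree f" for f g :: "'a poly" and x
  proof -
    let ?n = "degree f" and ?m = "degree g"
    let ?c = "coeff f ?n"
    have "?n \<noteq> 0"
    proof
      assume "?n = 0"
      then obtain c where c: "f = [:c:]" using degree_eq_zeroE by blast
      then have "(1, 0) \<in> G" using f(1)[of 0] f(2) by simp
      then show False using partial_hom_single_valued[OF G partial_hom_one[OF G]] by fastforce
    qed
    \<comment> \<open>Moving the constant term of \<open>g\<close> to the other side leaves the
      factor \<open>u\<close>, a unit of the domain, since its image is 1 and \<open>G\<close> is
      maximal.\<close>
    define u where "u = 1 - coeff g 0"
    have u: "(u, 1) \<in> G"
      using partial_hom_diff[OF G partial_hom_one[OF G] g(1)[of 0]] by (simp add: u_def)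
    have "u \<noteq> 0" using u G by (auto simp: partial_hom_def)
    have u': "(inverse u, 1) \<in> G" using maximal_partial_hom_inverse[OF u] by simp
    have "x ^ ?m = (\<Sum>j\<le>?m. coeff g j * x ^ (?m - j))"
    proof -
      have "x ^ ?m = x ^ ?m * poly g (inverse x)" using g(2) by simp
      also have "\<dots> = (\<Sum>j\<le>?m. coeff g j * x ^ (?m - j))"
        unfolding poly_sum_bound[OF order_refl] sum_distrib_left
        using x by (intro sum.cong) (auto simp: power_diff field_simps)
      finally show ?thesis .
    qed
    also have "{..?m} = insert 0 {1..?m}" by auto
    finally have "u * x ^ ?m = (\<Sum>j=1..?m. coeff g j * x ^ (?m - j))"
      by (simp add: u_def algebra_simps)
    then have xm: "x ^ ?m = (\<Sum>j=1..?m. coeff g j * inverse u * x ^ (?m - j))"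
      using \<open>u \<noteq> 0\<close> by (simp add: field_simps flip: sum_distrib_right sum_divide_distrib)
    \<comment> \<open>The leading term of \<open>f\<close> is rewritten by the formula for
      \<open>x ^ ?m\<close>, multiplied by \<open>x ^ (?n - ?m)\<close>. The sum starts at
      \<open>j = 1\<close>, so only powers below \<open>?n\<close> enter, and the new coefficients
      stay in the kernel.\<close>
    define f' where "f' = f - monom ?c ?n + (\<Sum>j=1..?m. monom (?c * coeff g j * inverse u) (?n - j))"
    have "x ^ ?n = x ^ (?n - ?m) * x ^ ?m" using deg by (simp flip: power_add)
    also have "\<dots> = (\<Sum>j=1..?m. coeff g j * inverse u * x ^ (?n - j))"
      unfolding xm sum_distrib_left
      using deg by (intro sum.cong) (auto simp: algebra_simps simp flip: power_add)
    finally have "poly f' x = 1"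
      using f(2) by (simp add: f'_def poly_sum poly_monom sum_distrib_left mult.assoc)
    moreover have "(coeff f' i, 0) \<in> G" for i
    proof -
      have *: "(if k = i then d else 0, 0) \<in> G" if "(d, 0) \<in> G" for k d
        using that partial_hom_zero[OF G] by auto
      have "(coeff f i - coeff (monom ?c ?n) i, 0 - 0) \<in> G"
        unfolding coeff_monom by (intro partial_hom_diff[OF G] f(1) *)
      moreover have "(\<Sum>j=1..?m. coeff (monom (?c * coeff g j * inverse u) (?n - j)) i, \<Sum>j=1..?m. 0) \<in> G"
        unfolding coeff_monom
        using partial_hom_mult[OF G partial_hom_mult[OF G f(1) g(1)] u']
        by (intro partial_hom_sum[OF G] *) simp
      ultimately have "(coeff f i - coeff (monom ?c ?n) i +
          (\<Sum>j=1..?m. coeff (monom (?c * coeff g j * inverse u) (?n - j)) i), (0 - 0) + (\<Sum>j=1..?m. 0)) \<in> G"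
        by (rule partial_hom_add[OF G])
      then show ?thesis by (simp add: f'_def coeff_sum)
    qed
    moreover have "degree f' < ?n"
    proof -
      have "coeff f' i = 0" if "i \<ge> ?n" for i
      proof -
        have "coeff (monom (?c * coeff g j * inverse u) (?n - j)) i = 0" if "j \<in> {1..?m}" for j
          using that \<open>i \<ge> ?n\<close> \<open>?n \<noteq> 0\<close> by auto
        then show ?thesis
          using that by (auto simp: f'_def coeff_sum coeff_eq_0)
      qed
      then show ?thesis using \<open>?n \<noteq> 0\<close> by (metis degree_0 gr0I leading_coeff_0_iff linorder_not_le)
    qed
    ultimately show ?thesis by blast
  qed
  show False
  proof (cases "degree g \<le> degree f")
    case True
    from reduce[OF less.prems(1-3) less.prems(4,5) True] obtain f' where
      "\<And>i. (coeff f' i, 0) \<in> G" "poly f' x = 1" "degree f' < degree f" by blast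
    with less.hyps[of f' g x] less.prems show False by simp
  next
    case False
    from reduce[of "inverse x" g f] less.prems False obtain g' where
      "\<And>i. (coeff g' i, 0) \<in> G" "poly g' (inverse x) = 1" "degree g' < degree g" by auto
    with less.hyps[of f g' x] less.prems show False by simp
  qed
qed

text \<open>The constant coefficient of \<open>f\<close> has a nonzero image and is thus a unit;
  dividing by it writes 1 as a polynomial in \<open>x\<close> with coefficients in the kernel. By
  the next lemma this is the only obstruction to adjoining \<open>x\<close>.\<close>

lemma maximal_partial_hom_const_relation:
  assumes "(f, g) \<in> coeff_pairs G" "poly f x = 0" "degree g = 0" "g \<noteq> 0"
  shows "\<exists>f'. (\<forall>i. (coeff f' i, 0) \<in> G) \<and> poly f' x = 1"
proof -
  obtain b where b: "g = [:b:]" using degree_eq_zeroE assms(3) by blast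
  then have "b \<noteq> 0" using assms(4) by simp
  let ?a = "coeff f 0"
  have ab: "(?a, b) \<in> G" using assms(1) b unfolding coeff_pairs_def by (auto dest!: spec[of _ 0])
  have "?a \<noteq> 0" using G ab \<open>b \<noteq> 0\<close> by (auto simp: partial_hom_def)
  define f' where "f' = smult (- inverse ?a) (f - [:?a:])"
  have "poly f' x = 1" using assms(2) \<open>?a \<noteq> 0\<close> by (simp add: f'_def)
  moreover have "(coeff f' i, 0) \<in> G" for i
  proof (cases i)
    case 0
    then show ?thesis by (simp add: f'_def partial_hom_zero[OF G])
  next
    case (Suc j)
    then have "(coeff f i, 0) \<in> G"
      using assms(1) b unfolding coeff_pairs_def by (auto dest!: spec[of _ i])
    from partial_hom_mult[OF G partial_hom_uminus[OF G maximal_partial_hom_inverse[OF ab \<open>b \<noteq> 0\<close>]] this]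
    show ?thesis using Suc by (simp add: f'_def)
  qed
  ultimately show ?thesis by blast
qed

end

text \<open>The images of the relations of \<open>x\<close> form an ideal of polynomials over the
  image of \<open>G\<close>, which is a field by maximality. A nonzero element of least degree
  generates it and, being nonconstant, has a root, to which \<open>x\<close> can be sent.\<close>

lemma maximal_partial_hom_domain:
  fixes G :: "('a::field \<times> 'b::alg_closed_field) set"
  assumes G: "partial_hom G"
    and maximal: "\<And>H. G \<subseteq> H \<Longrightarrow> partial_hom H \<Longrightarrow> H = G"
    and no_const: "\<And>f g. (f, g) \<in> coeff_pairs G \<Longrightarrow> poly f x = 0 \<Longrightarrow> degree g = 0 \<Longrightarrow> g = 0"
  shows "\<exists>\<alpha>. (x, \<alpha>) \<in> G"
proof -
  define J where "J = {g. \<exists>f. (f, g) \<in> coeff_pairs G \<and> poly f x = 0}"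
  have "\<exists>\<alpha>. \<forall>g\<in>J. poly g \<alpha> = 0"
  proof (cases "\<forall>g\<in>J. g = 0")
    \<comment> \<open>Without nontrivial relations, \<open>x\<close> can be sent anywhere.\<close>
    case True
    then show ?thesis by (metis poly_0)
  next
    case False
    then obtain g0 where "g0 \<in> J \<and> g0 \<noteq> 0" by blast
    then obtain g where "g \<in> J \<and> g \<noteq> 0"
      and "\<forall>h. h \<in> J \<and> h \<noteq> 0 \<longrightarrow> degree g \<le> degree h"
      using ex_has_least_nat[of "\<lambda>g. g \<in> J \<and> g \<noteq> 0" g0 degree] by blast
    then have gJ: "g \<in> J" and "g \<noteq> 0"
      and min: "\<And>h. h \<in> J \<Longrightarrow> h \<noteq> 0 \<Longrightarrow> degree g \<le> degree h" by blast+
    obtain f where fg: "(f, g) \<in> coeff_pairs G" "poly f x = 0" using gJ by (auto simp: J_def)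
    then have "degree g > 0" using no_const \<open>g \<noteq> 0\<close> by blast
    then obtain \<alpha> where \<alpha>: "poly g \<alpha> = 0" using alg_closed_imp_poly_has_root by blast
    have "poly h \<alpha> = 0" if "h \<in> J" for h
      using that
    proof (induction "degree h" arbitrary: h rule: less_induct)
      case less
      show ?case
      proof (cases "h = 0")
        case False
        let ?k = "degree h - degree g"
        have deg: "degree g \<le> degree h" using min less.prems False by blast
        obtain f' where f': "(f', h) \<in> coeff_pairs G" "poly f' x = 0"
          using less.prems by (auto simp: J_def)
        \<comment> \<open>This lifts the leading coefficient of \<open>g\<close>, although
          \<open>f\<close> may have higher terms, with coefficients in the kernel.\<close>
        have lg: "(coeff f (degree g), lead_coeff g) \<in> G" using fg(1) by (simp add: coeff_pairs_def)
        have lh: "(coeff f' (degree h), lead_coeff h) \<in> G" using f'(1) by (simp add: coeff_pairs_def)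
        have q: "(coeff f' (degree h) * inverse (coeff f (degree g)), lead_coeff h * inverse (lead_coeff g)) \<in> G"
          using \<open>g \<noteq> 0\<close>
          by (intro partial_hom_mult[OF G lh] maximal_partial_hom_inverse[OF G maximal lg]) auto
        define h' where "h' = h - monom (lead_coeff h * inverse (lead_coeff g)) ?k * g"
        have "h' \<in> J"
          using coeff_pairs_diff[OF G f'(1) coeff_pairs_mult[OF G coeff_pairs_monom[OF G q, of ?k] fg(1)]]
            f'(2) fg(2)
          unfolding J_def h'_def by fastforce
        moreover have "degree h' < degree h"
        proof (rule ccontr)
          assume "\<not> degree h' < degree h"
          moreover have "degree h' \<le> degree h"
          proof -
            have "degree (monom (lead_coeff h * inverse (lead_coeff g)) ?k * g) \<le> ?k + degree g"
              by (rule order_trans[OF degree_mult_le]) (simp add: degree_monom_le)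
            then show ?thesis unfolding h'_def using deg by (intro degree_diff_le) simp_all
          qed
          ultimately have d: "degree h' = degree h" by simp
          have "coeff h' (degree h) = 0"
            unfolding h'_def coeff_diff coeff_monom_mult
            using deg \<open>g \<noteq> 0\<close> by simp
          then have "h' = 0" using d by (metis leading_coeff_0_iff)
          then have "degree h = 0" using d by simp
          then show False using deg \<open>degree g > 0\<close> by simp
        qed
        ultimately have "poly h' \<alpha> = 0" using less.hyps by blast
        then show ?thesis using \<alpha> by (simp add: h'_def)
      qed simp
    qed
    then show ?thesis by blast
  qed
  then obtain \<alpha> where "\<And>f g. (f, g) \<in> coeff_pairs G \<Longrightarrow> poly f x = 0 \<Longrightarrow> poly g \<alpha> = 0"
    unfolding J_def by blast
  then have "\<exists>H. G \<subseteq> H \<and> (x, \<alpha>) \<in> H \<and> partial_hom H"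
    by (intro partial_hom_adjoin[OF G])
  then obtain H where "G \<subseteq> H" "(x, \<alpha>) \<in> H" "partial_hom H" by blast
  then show ?thesis using maximal[of H] by auto
qed

text \<open>Zorn's lemma gives a maximal extension. If neither \<open>x\<close> nor
  \<open>inverse x\<close> were in its domain, each would be obstructed by a relation that writes 1
  with kernel coefficients, and these two relations exclude each other.\<close>

theorem partial_hom_extend_to_place:
  fixes G :: "('a::field \<times> 'b::alg_closed_field) set"
  assumes "partial_hom G"
  shows "\<exists>H. G \<subseteq> H \<and> partial_hom H \<and> (\<forall>x. x \<noteq> 0 \<longrightarrow> x \<in> fst ` H \<or> inverse x \<in> fst ` H)
    \<and> (\<forall>a b. (a, b) \<in> H \<longrightarrow> b \<noteq> 0 \<longrightarrow> (inverse a, inverse b) \<in> H)"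
proof -
  let ?A = "{H. G \<subseteq> H \<and> partial_hom H}"
  have "\<exists>M\<in>?A. \<forall>X\<in>?A. M \<subseteq> X \<longrightarrow> X = M"
  proof (rule subset_Zorn_nonempty)
    show "?A \<noteq> {}" using assms by blast
    fix \<C> assume ne: "\<C> \<noteq> {}" and chain: "subset.chain ?A \<C>"
    have ph: "partial_hom H" if "H \<in> \<C>" for H
      using chain that by (auto simp: subset.chain_def)
    have "G \<subseteq> \<Union>\<C>" using ne chain by (force simp: subset.chain_def)
    moreover have "partial_hom (\<Union>\<C>)"
    proof (rule partial_homI)
      show "(1, 1) \<in> \<Union>\<C>" using ne ph partial_hom_one by blast
      show "b = 0" if "(0, b) \<in> \<Union>\<C>" for b
        using that ph by (auto simp: partial_hom_def)
      fix a b c d assume "(a, b) \<in> \<Union>\<C>" "(c, d) \<in> \<Union>\<C>"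
      then obtain H1 H2 where 12: "H1 \<in> \<C>" "(a, b) \<in> H1" "H2 \<in> \<C>" "(c, d) \<in> H2" by blast
      then have "H1 \<subseteq> H2 \<or> H2 \<subseteq> H1" using chain unfolding subset.chain_def by blast
      with 12 obtain H where "H \<in> \<C>" "(a, b) \<in> H" "(c, d) \<in> H" by blast
      then show "(a - c, b - d) \<in> \<Union>\<C>" "(a * c, b * d) \<in> \<Union>\<C>"
        using ph partial_hom_diff partial_hom_mult by blast+
    qed
    ultimately show "\<Union>\<C> \<in> ?A" by simp
  qed
  then obtain H where "H \<in> ?A" and max_A: "\<forall>X\<in>?A. H \<subseteq> X \<longrightarrow> X = H" by blast
  then have GH: "G \<subseteq> H" and H: "partial_hom H" by simp_all
  have maximal: "X = H" if "H \<subseteq> X" "partial_hom X" for X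
    using max_A that GH by blast
  have "x \<in> fst ` H \<or> inverse x \<in> fst ` H" if "x \<noteq> 0" for x
  proof (rule ccontr)
    assume not: "\<not> ?thesis"
    have "\<exists>f'. (\<forall>i. (coeff f' i, 0) \<in> H) \<and> poly f' y = 1" if "y \<notin> fst ` H" for y
    proof -
      have "\<nexists>\<alpha>. (y, \<alpha>) \<in> H" using that by force
      then have "\<not> (\<forall>f g. (f, g) \<in> coeff_pairs H \<longrightarrow> poly f y = 0 \<longrightarrow> degree g = 0 \<longrightarrow> g = 0)"
        using maximal_partial_hom_domain[OF H maximal, of y] by blast
      then show ?thesis using maximal_partial_hom_const_relation[OF H maximal] by blast
    qed
    with not show False
      using maximal_partial_hom_not_both[OF H maximal \<open>x \<noteq> 0\<close>] by blast
  qed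
  moreover have "(inverse a, inverse b) \<in> H" if "(a, b) \<in> H" "b \<noteq> 0" for a b
    using maximal_partial_hom_inverse[OF H maximal that] .
  ultimately show ?thesis using GH H by blast
qed

section \<open>Kronecker substitution and the Nullstellensatz for a hypersurface\<close>

text \<open>Distinct exponents turn each linear form into a nonzero polynomial in \<open>t\<close>,
  with finitely many roots. \<open>T\<close> is a parameter because the lemma serves both to find
  positive integer weights and to specialize \<open>u\<close> in the field.\<close>

lemma moment_curve_avoids_hyperplanes:
  fixes T :: "'a::idom set"
  assumes "finite V" "inj_on idx V" "finite L" "infinite T"
    and "\<And>l. l \<in> L \<Longrightarrow> \<exists>v\<in>V. l v \<noteq> 0"
  shows "\<exists>t\<in>T. \<forall>l\<in>L. (\<Sum>v\<in>V. l v * t ^ idx v) \<noteq> 0"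
proof -
  define q where "q l = (\<Sum>v\<in>V. monom (l v) (idx v))" for l :: "_ \<Rightarrow> 'a"
  have "q l \<noteq> 0" if l: "l \<in> L" for l
  proof -
    obtain v where v: "v \<in> V" "l v \<noteq> 0" using assms(5)[OF l] by blast
    have "coeff (q l) (idx v) = (\<Sum>v'\<in>V. if v' = v then l v' else 0)"
      unfolding q_def coeff_sum coeff_monom
      using assms(2) v(1) by (intro sum.cong) (auto simp: inj_on_def)
    also have "\<dots> = l v" using v(1) assms(1) by simp
    finally show ?thesis using v(2) by auto
  qed
  then have "finite (\<Union>l\<in>L. {t. poly (q l) t = 0})"
    using assms(3) by (auto simp: poly_roots_finite)
  then obtain t where "t \<in> T" "t \<notin> (\<Union>l\<in>L. {t. poly (q l) t = 0})"
    using assms(4) by (metis finite_subset subsetI)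
  then show ?thesis by (auto simp: q_def poly_sum poly_monom)
qed

definition monom_weight :: "('v \<Rightarrow> nat) \<Rightarrow> ('v \<Rightarrow>\<^sub>0 nat) \<Rightarrow> nat"
  where "monom_weight w m = (\<Sum>v\<in>msupport m. mcoeff m v * w v)"

lemma monom_weight_superset:
  assumes "finite V" "msupport m \<subseteq> V"
  shows "monom_weight w m = (\<Sum>v\<in>V. mcoeff m v * w v)"
  unfolding monom_weight_def using assms
  by (intro sum.mono_neutral_left) (auto simp: in_keys_iff)

text \<open>Differences of distinct exponent vectors are nonzero linear forms, avoided by a point of
  the moment curve with a positive integer parameter.\<close>

lemma ex_separating_weights:
  assumes "finite (M :: ('v \<Rightarrow>\<^sub>0 nat) set)"
  shows "\<exists>w. (\<forall>v. w v > 0) \<and> inj_on (monom_weight w) M"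
proof -
  define V where "V = (\<Union>m\<in>M. msupport m)"
  have V: "finite V" using assms by (simp add: V_def)
  obtain idx :: "'v \<Rightarrow> nat" where idx: "inj_on idx V"
    using finite_imp_inj_to_nat_seg[OF V] by blast
  define d where "d m m' v = int (mcoeff m v) - int (mcoeff m' v)" for m m' :: "'v \<Rightarrow>\<^sub>0 nat" and v
  define L where "L = (\<lambda>(m, m'). d m m') ` {(m, m') \<in> M \<times> M. m \<noteq> m'}"
  have "finite L" unfolding L_def using assms by (auto intro: finite_subset[of _ "M \<times> M"])
  moreover have "\<exists>v\<in>V. l v \<noteq> 0" if lL: "l \<in> L" for l
  proof -
    obtain m m' where m: "m \<in> M" "m' \<in> M" "m \<noteq> m'"
      and l: "l = d m m'"
      using lL by (auto simp: L_def)
    obtain v where "mcoeff m v \<noteq> mcoeff m' v" using m(3) by (auto simp: poly_mapping_eq_iff fun_eq_iff)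
    moreover from this have "v \<in> msupport m \<or> v \<in> msupport m'" by (auto simp: in_keys_iff)
    then have "v \<in> V" unfolding V_def using m(1,2) by blast
    ultimately show ?thesis using l by (auto simp: d_def)
  qed
  moreover have "infinite (int ` {1..})"
    by (simp add: finite_image_iff infinite_Ici)
  ultimately obtain t where "t \<in> int ` {1..}" "\<forall>l\<in>L. (\<Sum>v\<in>V. l v * t ^ idx v) \<noteq> 0"
    using moment_curve_avoids_hyperplanes[OF V idx, of L "int ` {1..}"] by blast
  then obtain k where k: "k \<ge> 1" and avoid: "\<And>l. l \<in> L \<Longrightarrow> (\<Sum>v\<in>V. l v * int k ^ idx v) \<noteq> 0"
    by auto
  have "inj_on (monom_weight (\<lambda>v. k ^ idx v)) M"
  proof (rule inj_onI, rule ccontr)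
    fix m m' assume *: "m \<in> M" "m' \<in> M" "m \<noteq> m'"
      and eq: "monom_weight (\<lambda>v. k ^ idx v) m = monom_weight (\<lambda>v. k ^ idx v) m'"
    have "msupport m \<subseteq> V" "msupport m' \<subseteq> V" using * by (auto simp: V_def)
    then have "int (\<Sum>v\<in>V. mcoeff m v * k ^ idx v) = int (\<Sum>v\<in>V. mcoeff m' v * k ^ idx v)"
      using eq by (simp add: monom_weight_superset[OF V])
    then have "(\<Sum>v\<in>V. d m m' v * int k ^ idx v) = 0"
      by (simp add: d_def left_diff_distrib sum_subtractf)
    then show False using avoid[of "d m m'"] * by (auto simp: L_def)
  qed
  then show ?thesis using k by (intro exI[of _ "\<lambda>v. k ^ idx v"]) simp
qed

definition kronecker :: "('v \<Rightarrow> nat) \<Rightarrow> ('v, int) mpoly \<Rightarrow> 'r::comm_ring_1 poly"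
  where "kronecker w = mpoly_eval of_int (\<lambda>v. monom 1 (w v))"

lemma mpoly_monom_monom: "mpoly_monom (\<lambda>v. monom 1 (w v)) m = monom 1 (monom_weight w m)"
proof -
  have "(\<Prod>v\<in>S. monom (1::'a) (k v)) = monom 1 (\<Sum>v\<in>S. k v)" for S and k :: "'b \<Rightarrow> nat"
    by (induction S rule: infinite_finite_induct) (simp_all add: mult_monom)
  then show ?thesis
    by (simp add: mpoly_monom_def monom_weight_def monom_power mult.commute)
qed

text \<open>Separating weights send the monomials to distinct powers, so the univariate image
  retains every coefficient.\<close>

lemma coeff_kronecker:
  assumes "finite M" "inj_on (monom_weight w) M" "msupport p \<subseteq> M" "m \<in> M"
  shows "coeff (kronecker w p :: 'r::comm_ring_1 poly) (monom_weight w m) = of_int (mcoeff p m)"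
proof -
  let ?k = "kronecker w p :: 'r poly"
  have "?k = (\<Sum>m\<in>M. monom (of_int (mcoeff p m)) (monom_weight w m))"
    unfolding kronecker_def using assms
    by (simp add: mpoly_eval_superset[of of_int M] mpoly_monom_monom of_int_poly smult_monom)
  then have "coeff ?k (monom_weight w m)
      = (\<Sum>m'\<in>M. coeff (monom (of_int (mcoeff p m')) (monom_weight w m')) (monom_weight w m))"
    by (simp only: coeff_sum)
  also have "\<dots> = (\<Sum>m'\<in>M. if m' = m then of_int (mcoeff p m') else 0)"
    using assms(2,4) by (intro sum.cong) (auto simp: inj_on_def)
  finally have "coeff ?k (monom_weight w m)
      = (\<Sum>m'\<in>M. if m' = m then of_int (mcoeff p m') else 0)" .
  then show ?thesis using assms(1,4) by simp
qed

text \<open>A Kronecker substitution that retains all coefficients turns \<open>r\<close> into a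
  univariate polynomial that vanishes on all complex numbers.\<close>

lemma mpoly_eq_0_if_vanishing:
  fixes r :: "('v, int) mpoly"
  assumes "\<And>c :: 'v \<Rightarrow> complex. mpoly_eval of_int c r = 0"
  shows "r = 0"
proof (rule poly_mapping_eqI)
  fix m
  obtain w where inj: "inj_on (monom_weight w) (msupport r)"
    using ex_separating_weights[of "msupport r"] by auto
  have "poly (kronecker w r) z = 0" for z :: complex
  proof -
    interpret pz: ring_hom_fun "\<lambda>f. poly f z" by (rule ring_hom_fun_poly)
    show ?thesis
      by (simp add: kronecker_def pz.mpoly_eval_int_hom assms)
  qed
  then have *: "kronecker w r = (0 :: complex poly)" using poly_all_0_iff_0 by blast
  show "mcoeff r m = mcoeff 0 m"
  proof (cases "m \<in> msupport r")
    case True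
    have "coeff (kronecker w r :: complex poly) (monom_weight w m) = of_int (mcoeff r m)"
      by (rule coeff_kronecker[OF _ inj _ True]) auto
    then show ?thesis using * by simp
  qed (simp add: in_keys_iff)
qed

text \<open>The degree conditions are expressed by vanishing coefficients, so that for
  \<open>D = 0\<close> the remainder is zero.\<close>

lemma pseudo_division:
  fixes f g :: "'a::comm_ring_1 poly"
  assumes "\<And>i. i > D \<Longrightarrow> coeff g i = 0"
  shows "\<exists>s h r. smult (coeff g D ^ s) f = g * h + r \<and> (\<forall>i\<ge>D. coeff r i = 0)"
proof -
  let ?m = "coeff g D"
  have "\<exists>s h r. smult (?m ^ s) f = g * h + r \<and> (\<forall>i\<ge>D. coeff r i = 0)"
    if "\<And>i. i \<ge> n \<Longrightarrow> coeff f i = 0" for n f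
    using that
  proof (induction n arbitrary: f)
    case 0
    then have "f = 0" by (auto intro: poly_eqI)
    then show ?case by (intro exI[of _ 0]) simp
  next
    case (Suc n)
    show ?case
    proof (cases "n < D")
      case True
      then show ?thesis using Suc.prems by (intro exI[of _ 0] exI[of _ f]) simp
    next
      case False
      define q where "q = monom (coeff f n) (n - D)"
      have "coeff (smult ?m f - q * g) i = 0" if "i \<ge> n" for i
      proof (cases "i = n")
        case True
        then show ?thesis using False by (simp add: q_def coeff_monom_mult)
      next
        case ne: False
        then have "coeff f i = 0" "coeff g (i - (n - D)) = 0"
          using that False by (auto intro!: Suc.prems assms)
        then show ?thesis by (simp add: q_def coeff_monom_mult)
      qed
      from Suc.IH[OF this] obtain s h r where
        *: "smult (?m ^ s) (smult ?m f - q * g) = g * h + r" "\<forall>i\<ge>D. coeff r i = 0" by blast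
      have "smult (?m ^ Suc s) f = g * (h + smult (?m ^ s) q) + r"
        using *(1) by (simp add: smult_diff_right algebra_simps)
      then show ?thesis using *(2) by blast
    qed
  qed
  from this[of "Suc (degree f)"] show ?thesis by (simp add: coeff_eq_0)
qed

text \<open>Leading coefficient 1 makes degrees additive over any commutative ring, in particular
  over the polynomial ring used next.\<close>

definition monic_of_degree :: "'a::comm_ring_1 poly \<Rightarrow> nat \<Rightarrow> bool"
  where "monic_of_degree f d \<longleftrightarrow> degree f = d \<and> lead_coeff f = 1"

lemma monic_of_degree_1: "monic_of_degree 1 0"
  by (simp add: monic_of_degree_def)

lemma monic_of_degree_mult:
  assumes "monic_of_degree f d" "monic_of_degree g e"
  shows "monic_of_degree (f * g) (d + e)"
proof -
  have *: "coeff (f * g) (d + e) = 1"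
    using assms coeff_mult_degree_sum[of f g] by (auto simp: monic_of_degree_def)
  then have "degree (f * g) = d + e"
    using assms degree_mult_le[of f g] le_degree[of "f * g" "d + e"]
    by (simp add: monic_of_degree_def)
  with * show ?thesis by (simp add: monic_of_degree_def)
qed

text \<open>The polynomial \<open>p\<close> at \<open>X_v + t ^ w v\<close>, as a polynomial in a
  new variable \<open>t\<close>, the \<open>X_v\<close> staying variables: for positive weights
  \<open>t = 0\<close> gives back \<open>p\<close>, while for separating weights the leading
  coefficient is an integer.\<close>

definition translate_poly :: "('v \<Rightarrow> nat) \<Rightarrow> ('v, int) mpoly \<Rightarrow> ('v, int) mpoly poly"
  where "translate_poly w = mpoly_eval of_int (\<lambda>v. [:mpoly_var v:] + monom 1 (w v))"

text \<open>Each monomial \<open>m\<close> becomes monic in \<open>t\<close>, of degree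
  \<open>monom_weight w m\<close>. As the weights separate, the highest degree comes from one
  monomial only, whose coefficient cannot cancel.\<close>

lemma translate_poly_leading_coeff:
  assumes w: "\<And>v. w v > 0" and inj: "inj_on (monom_weight w) (msupport p)" and "p \<noteq> 0"
  shows "\<exists>D a. a \<noteq> 0 \<and> coeff (translate_poly w p) D = of_int a \<and>
    (\<forall>i>D. coeff (translate_poly w p) i = 0)"
proof -
  define t :: "'a \<Rightarrow> ('a, int) mpoly poly" where "t v = [:mpoly_var v:] + monom 1 (w v)" for v
  have t: "monic_of_degree (t v) (w v)" for v
  proof -
    have "degree (t v) = w v"
      unfolding t_def using w[of v] by (subst degree_add_eq_right) (auto simp: degree_monom_eq)
    moreover have "coeff (t v) (w v) = 1"
      unfolding t_def using w[of v] by (auto simp: coeff_pCons split: nat.splits)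
    ultimately show ?thesis by (simp add: monic_of_degree_def)
  qed
  have pow: "monic_of_degree (t v ^ k) (k * w v)" for v k
    by (induction k) (simp_all add: monic_of_degree_1 monic_of_degree_mult t)
  have prod: "monic_of_degree (\<Prod>v\<in>S. t v ^ k v) (\<Sum>v\<in>S. k v * w v)"
    if "finite S" for S k
    using that
    by (induction S rule: finite_induct) (simp_all add: monic_of_degree_1 monic_of_degree_mult pow)
  have mon: "degree (mpoly_monom t m) = monom_weight w m" "lead_coeff (mpoly_monom t m) = 1" for m
    using prod[of "msupport m" "mcoeff m"]
    by (auto simp: monic_of_degree_def mpoly_monom_def monom_weight_def)
  have eq: "translate_poly w p = (\<Sum>m\<in>msupport p. smult (of_int (mcoeff p m)) (mpoly_monom t m))"
    by (simp add: translate_poly_def mpoly_eval_eq t_def[abs_def] of_int_poly)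
  define D where "D = Max (monom_weight w ` msupport p)"
  have ne: "msupport p \<noteq> {}" using \<open>p \<noteq> 0\<close> by (auto simp: poly_mapping_eq_iff fun_eq_iff in_keys_iff)
  then have "D \<in> monom_weight w ` msupport p" unfolding D_def by (intro Max_in) auto
  then obtain m where m: "m \<in> msupport p" "D = monom_weight w m" by blast
  have le: "monom_weight w m' \<le> D" if "m' \<in> msupport p" for m'
    unfolding D_def using that by simp
  have "coeff (mpoly_monom t m') D = (if m' = m then 1 else 0)" if "m' \<in> msupport p" for m'
  proof (cases "m' = m")
    case True
    then show ?thesis using mon[of m] m(2) by simp
  next
    case False
    then have "monom_weight w m' \<noteq> D" using inj m that by (auto simp: inj_on_def)
    then show ?thesis using le[OF that] mon(1)[of m'] False by (simp add: coeff_eq_0)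
  qed
  then have "coeff (translate_poly w p) D
      = (\<Sum>m'\<in>msupport p. if m' = m then of_int (mcoeff p m') else 0)"
    unfolding eq coeff_sum by (intro sum.cong) auto
  then have "coeff (translate_poly w p) D = of_int (mcoeff p m)" using m(1) by simp
  moreover have "coeff (translate_poly w p) i = 0" if "i > D" for i
    unfolding eq coeff_sum using le mon(1) that by (intro sum.neutral) (force simp: coeff_eq_0)
  ultimately show ?thesis using m(1) by (intro exI[of _ D] exI[of _ "mcoeff p m"]) (auto simp: in_keys_iff)
qed

lemma poly_translate_poly_0:
  assumes "\<And>v. w v > 0"
  shows "poly (translate_poly w p) 0 = p"
proof -
  interpret p0: ring_hom_fun "\<lambda>f :: ('a, int) mpoly poly. poly f 0" by (rule ring_hom_fun_poly)
  have "(0 :: ('a, int) mpoly) ^ w v = 0" for v using assms[of v] by (simp add: power_0_left)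
  then show ?thesis
    by (simp add: translate_poly_def p0.mpoly_eval_int_hom poly_monom mpoly_eval_var_id)
qed

lemma translate_poly_specialize:
  fixes c :: "'v \<Rightarrow> complex"
  shows "poly (map_poly (mpoly_eval of_int c) (translate_poly w p)) z
    = mpoly_eval of_int (\<lambda>v. c v + z ^ w v) p"
proof -
  interpret m: ring_hom_fun "map_poly (mpoly_eval of_int c)"
    by (rule ring_hom_fun_map_poly) unfold_locales
  interpret pz: ring_hom_fun "\<lambda>f. poly f z" by (rule ring_hom_fun_poly)
  have "map_poly (mpoly_eval of_int c) ([:mpoly_var v:] + monom 1 (w v)) = [:c v:] + monom 1 (w v)" for v
    by (simp add: m.add map_poly_pCons map_poly_monom ev_int.zero ev_int.one mpoly_eval_var)
  then show ?thesis
    by (simp add: translate_poly_def m.mpoly_eval_int_hom pz.mpoly_eval_int_hom poly_monom)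
qed

text \<open>Along the curves \<open>t \<mapsto> (c\<^sub>v + t\<^bsup>w v\<^esup>)\<close> with separating weights, \<open>p\<close> has a constant leading
  coefficient in \<open>t\<close>, so pseudo-division over the polynomial ring reduces the claim to univariate
  polynomials over the complex numbers.\<close>

lemma power_multiple_if_vanishing:
  fixes p q :: "('v, int) mpoly"
  assumes "p \<noteq> 0"
    and van: "\<And>c :: 'v \<Rightarrow> complex. mpoly_eval of_int c p = 0 \<Longrightarrow> mpoly_eval of_int c q = 0"
  shows "\<exists>a D h. a \<noteq> 0 \<and> of_int a * q ^ D = p * h"
proof -
  obtain w where w: "\<And>v. w v > 0" and inj: "inj_on (monom_weight w) (msupport p)"
    using ex_separating_weights[of "msupport p"] by auto
  let ?p = "translate_poly w p" and ?q = "translate_poly w q"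
  obtain D a where "a \<noteq> 0" and lc: "coeff ?p D = of_int a" and deg: "\<And>i. i > D \<Longrightarrow> coeff ?p i = 0"
    using translate_poly_leading_coeff[OF w inj \<open>p \<noteq> 0\<close>] by blast
  \<comment> \<open>\<open>D\<close> is the degree in \<open>t\<close> of every complex
    specialization of \<open>?p\<close>, because the leading coefficient is a nonzero integer. It is
    thus the exponent in the univariate Nullstellensatz, and one division serves all
    \<open>c\<close>.\<close>
  obtain s h r where div: "smult (of_int a ^ s) (?q ^ D) = ?p * h + r" and r: "\<And>i. i \<ge> D \<Longrightarrow> coeff r i = 0"
    using pseudo_division[of D ?p "?q ^ D", OF deg] unfolding lc by blast
  have "mpoly_eval of_int c (coeff r i) = 0" for c :: "'v \<Rightarrow> complex" and i
  proof -
    let ?ev = "mpoly_eval of_int c"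
    interpret m: ring_hom_fun "map_poly ?ev"
      by (rule ring_hom_fun_map_poly) unfold_locales
    have coeff_ev: "coeff (map_poly ?ev f) j = ?ev (coeff f j)" for f j
      by (simp add: coeff_map_poly ev_int.zero)
    have p_lc: "coeff (map_poly ?ev ?p) D \<noteq> 0"
      using \<open>a \<noteq> 0\<close> by (simp add: coeff_ev lc ev_int.of_int)
    have p_deg: "degree (map_poly ?ev ?p) = D"
      using p_lc deg by (intro antisym degree_le le_degree) (auto simp: coeff_ev ev_int.zero)
    have "map_poly ?ev ?p dvd map_poly ?ev ?q ^ D"
    proof -
      have "\<forall>z. poly (map_poly ?ev ?p) z = 0 \<longrightarrow> poly (map_poly ?ev ?q) z = 0"
        by (simp add: translate_poly_specialize van)
      then show ?thesis
        unfolding nullstellensatz_univariate p_deg using p_lc by auto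
    qed
    moreover have "map_poly ?ev r = smult (of_int a ^ s) (map_poly ?ev ?q ^ D) - map_poly ?ev ?p * map_poly ?ev h"
    proof -
      have *: "map_poly ?ev (smult b f) = smult (?ev b) (map_poly ?ev f)" for b f
        by (rule poly_eqI) (simp add: coeff_ev ev_int.mult)
      have "r = smult (of_int a ^ s) (?q ^ D) - ?p * h" using div by simp
      then show ?thesis by (simp only: m.diff * m.power m.mult ev_int.power ev_int.of_int)
    qed
    ultimately have dvd: "map_poly ?ev ?p dvd map_poly ?ev r"
      by (auto intro: dvd_diff dvd_smult)
    \<comment> \<open>A polynomial of degree \<open>D\<close> divides a remainder whose coefficients
      vanish from \<open>D\<close> on.\<close>
    have "map_poly ?ev r = 0"
    proof (rule ccontr)
      assume ne: "map_poly ?ev r \<noteq> 0"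
      then have "D \<le> degree (map_poly ?ev r)" using dvd_imp_degree_le[OF dvd] p_deg by simp
      then have "lead_coeff (map_poly ?ev r) = 0" using r by (simp add: coeff_ev ev_int.zero)
      then show False using ne by simp
    qed
    then show ?thesis using coeff_ev[of r i] by simp
  qed
  then have "coeff r i = 0" for i by (rule mpoly_eq_0_if_vanishing)
  then have "r = 0" by (intro poly_eqI) simp
  with div have "poly (smult (of_int a ^ s) (?q ^ D)) 0 = poly (?p * h) 0" by simp
  then have "of_int (a ^ s) * q ^ D = p * poly h 0"
    by (simp add: poly_translate_poly_0[OF w])
  then show ?thesis using \<open>a \<noteq> 0\<close> by (metis power_not_zero)
qed

text \<open>Gauss' lemma, carried over from one variable: a Kronecker substitution keeps the
  coefficients of \<open>p\<close> and \<open>h\<close>, so the image of \<open>p\<close> has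
  content 1 and \<open>a\<close> divides the content of the image of \<open>h\<close>.\<close>

lemma primitive_mpoly_dvd_cancel:
  fixes p q h :: "('v, int) mpoly"
  assumes prim: "primitive_mpoly p" and "a \<noteq> 0" and eq: "of_int a * q = p * h"
  shows "p dvd q"
proof -
  have scale: "mcoeff (of_int a * f) m = a * mcoeff f m" for f :: "('v, int) mpoly" and m
  proof -
    have "of_int a = (Poly_Mapping.single 0 a :: ('v, int) mpoly)"
      using single_of_int[of a, where ?'a = "'v \<Rightarrow>\<^sub>0 nat" and ?'b = int] by simp
    then have "of_int a * f = Poly_Mapping.map ((*) a) f"
      by (simp add: mult_map_scale_conv_mult)
    then show ?thesis by (simp add: Poly_Mapping.map.rep_eq when_def)
  qed
  define M where "M = msupport p \<union> msupport h"
  have M: "finite M" by (simp add: M_def)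
  obtain w where inj: "inj_on (monom_weight w) M" using ex_separating_weights[OF M] by blast
  let ?K = "kronecker w :: ('v, int) mpoly \<Rightarrow> int poly"
  have Kp: "coeff (?K p) (monom_weight w m) = mcoeff p m" if "m \<in> M" for m
    using coeff_kronecker[OF M inj _ that, of p, where ?'r = int] by (simp add: M_def)
  have Kh: "coeff (?K h) (monom_weight w m) = mcoeff h m" if "m \<in> M" for m
    using coeff_kronecker[OF M inj _ that, of h, where ?'r = int] by (simp add: M_def)
  have "content (?K p) dvd mcoeff p m" if "m \<in> msupport p" for m
    using content_dvd_coeff[of "?K p" "monom_weight w m"] Kp[of m] that by (simp add: M_def)
  then have "content (?K p) dvd Gcd (mcoeff p ` msupport p)"
    by (intro Gcd_greatest) auto
  then have "content (?K p) = 1"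
    using prim normalize_content[of "?K p"] by (simp add: primitive_mpoly_def is_unit_normalize)
  moreover have "smult a (?K q) = ?K p * ?K h"
    using arg_cong[OF eq, of ?K]
    by (simp add: kronecker_def ev_int.mult ev_int.of_int of_int_poly)
  ultimately have "normalize a * content (?K q) = content (?K h)"
    by (metis content_mult content_smult mult_1)
  then have "a dvd content (?K h)" by (metis dvd_triv_left normalize_dvd_iff)
  then have "a dvd coeff (?K h) j" for j
    using content_dvd_coeff dvd_trans by blast
  then have dvd: "a dvd mcoeff h m" for m
    using Kh[of m] by (cases "m \<in> M") (metis, simp add: M_def in_keys_iff)
  define h' where "h' = Poly_Mapping.map (\<lambda>b. b div a) h"
  have "h = of_int a * h'"
    using dvd by (intro poly_mapping_eqI) (auto simp: scale h'_def Poly_Mapping.map.rep_eq when_def)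
  then have "of_int a * q = of_int a * (p * h')" using eq by (simp add: mult.left_commute)
  then have "q = p * h'"
    using scale[of q] scale[of "p * h'"] \<open>a \<noteq> 0\<close> by (intro poly_mapping_eqI) (metis mult_cancel_left)
  then show ?thesis by simp
qed

text \<open>Once primitivity has cancelled the integer \<open>a\<close>, the divisibility of
  \<open>q ^ D\<close> by \<open>p\<close> holds over the integers and can be evaluated in any
  integral domain, even one in which \<open>a\<close> becomes 0.\<close>

theorem hypersurface_nullstellensatz:
  fixes p q :: "('v, int) mpoly" and x :: "'v \<Rightarrow> 'k::idom"
  assumes "primitive_mpoly p"
    and "\<And>c :: 'v \<Rightarrow> complex. mpoly_eval of_int c p = 0 \<Longrightarrow> mpoly_eval of_int c q = 0"
    and "mpoly_eval of_int x p = 0"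
  shows "mpoly_eval of_int x q = 0"
proof -
  have "p \<noteq> 0" using assms(1) by (auto simp: primitive_mpoly_def)
  then obtain a D h where "a \<noteq> 0" "of_int a * q ^ D = p * h"
    using power_multiple_if_vanishing assms(2) by blast
  then obtain h' where "q ^ D = p * h'"
    using primitive_mpoly_dvd_cancel[OF assms(1)] by (metis dvdE)
  then have "mpoly_eval of_int x q ^ D = 0"
    using assms(3) by (metis ev_int.power ev_int.mult mult_zero_left)
  then show ?thesis by simp
qed

section \<open>Generic solvable systems and their specializations\<close>

definition laurent_monom :: "'k::field ^ 'n::finite \<Rightarrow> int ^ 'n \<Rightarrow> 'k"
  where "laurent_monom x e = (\<Prod>k\<in>UNIV. (x $ k) powi (e $ k))"

lemma laurent_monom_0 [simp]: "laurent_monom x 0 = 1"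
  by (simp add: laurent_monom_def)

lemma laurent_monom_add:
  assumes "\<And>k. x $ k \<noteq> 0"
  shows "laurent_monom x (a + b) = laurent_monom x a * laurent_monom x b"
  using assms by (simp add: laurent_monom_def power_int_add prod.distrib)

lemma laurent_monom_uminus: "laurent_monom x (- a) = inverse (laurent_monom x a)"
  by (simp add: laurent_monom_def power_int_minus prod_inversef[symmetric] comp_def)

lemma laurent_monom_nonzero: "(\<And>k. x $ k \<noteq> 0) \<Longrightarrow> laurent_monom x a \<noteq> 0"
  by (simp add: laurent_monom_def)

lemma partial_hom_laurent_monom:
  assumes H: "partial_hom H"
    and inv: "\<And>a b. (a, b) \<in> H \<Longrightarrow> b \<noteq> 0 \<Longrightarrow> (inverse a, inverse b) \<in> H"
    and xy: "\<And>k. (x $ k, y $ k) \<in> H" "\<And>k. y $ k \<noteq> 0"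
  shows "(laurent_monom x e, laurent_monom y e) \<in> H"
  unfolding laurent_monom_def power_int_def
  by (intro partial_hom_prod[OF H]) (auto intro!: partial_hom_power[OF H] xy inv)

text \<open>Numbering the unknowns by \<open>nat\<close> provides an order on the monomials, by
  which the polynomial ring is an integral domain.\<close>

type_synonym generic_field = "(nat, int) mpoly fract"

lemma mpoly_var_nonzero: "(mpoly_var v :: ('v, int) mpoly) \<noteq> 0"
  unfolding mpoly_var_def by (metis lookup_single_eq lookup_zero zero_neq_one)

text \<open>The root and all but one coefficient of each equation are free unknowns, and the last
  coefficient is solved for. Every solvable complex system with its root is a value of these
  unknowns, and a place carries the relations of \<open>C\<close> over to it.\<close>

theorem ex_generic_solution:
  fixes E :: "'i::finite \<Rightarrow> (int ^ 'n::finite) set"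
  assumes fin: "\<And>i. finite (E i)" and ne: "\<And>i. E i \<noteq> {}"
  shows "\<exists>(C :: 'i \<times> (int ^ 'n) \<Rightarrow> generic_field) x. (\<forall>k. x $ k \<noteq> 0) \<and>
    (\<forall>i e. e \<notin> E i \<longrightarrow> C (i, e) = 0) \<and>
    (\<forall>i. (\<Sum>e\<in>E i. C (i, e) * laurent_monom x e) = 0) \<and>
    (\<forall>q z. z \<in> solvable_coeffs E \<longrightarrow> mpoly_eval of_int C q = 0 \<longrightarrow> mpoly_eval of_int z q = 0)"
proof -
  define S where "S = (SIGMA i:UNIV. E i) <+> (UNIV :: 'n set)"
  have "finite S" unfolding S_def using fin by simp
  then obtain b :: "('i \<times> (int ^ 'n)) + 'n \<Rightarrow> nat" where b: "inj_on b S"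
    using finite_imp_inj_to_nat_seg by blast
  define X :: "nat \<Rightarrow> generic_field" where "X j = Fract (mpoly_var j) 1" for j
  have X_nz: "X j \<noteq> 0" for j
    using mpoly_var_nonzero[of j] by (simp add: X_def Zero_fract_def eq_fract)
  define x :: "generic_field ^ 'n" where "x = (\<chi> k. X (b (Inr k)))"
  have x_nz: "x $ k \<noteq> 0" for k by (simp add: x_def X_nz)
  define e0 where "e0 i = (SOME e. e \<in> E i)" for i
  have e0: "e0 i \<in> E i" for i unfolding e0_def using ne[of i] by (simp add: some_in_eq)
  \<comment> \<open>Equation \<open>i\<close> is divided by the monomial of \<open>e0 i\<close> and
    solved for its coefficient.\<close>
  define C where "C = (\<lambda>(i, e). if e \<notin> E i then 0
    else if e = e0 i then - (\<Sum>e\<in>E i - {e0 i}. X (b (Inl (i, e))) * laurent_monom x e) * laurent_monom x (- e0 i)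
    else X (b (Inl (i, e))))"
  have split: "(\<Sum>e\<in>E i. f e) = f (e0 i) + (\<Sum>e\<in>E i - {e0 i}. f e)" for f :: "_ \<Rightarrow> 'r::comm_ring_1" and i
    using fin e0 by (simp add: sum.remove)
  have rel: "(\<Sum>e\<in>E i. C (i, e) * laurent_monom x e) = 0" for i
  proof -
    have "laurent_monom x (- e0 i) * laurent_monom x (e0 i) = 1"
      using laurent_monom_nonzero[of x "e0 i"] x_nz by (simp add: laurent_monom_uminus)
    then show ?thesis
      by (simp add: split C_def e0 mult.assoc)
  qed
  have spec: "mpoly_eval of_int z q = 0" if z: "z \<in> solvable_coeffs E" and q: "mpoly_eval of_int C q = 0" for z q
  proof -
    obtain y :: "complex ^ 'n" where y_nz: "\<And>k. y $ k \<noteq> 0"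
      and y: "\<And>i. (\<Sum>e\<in>E i. z (i, e) * laurent_monom y e) = 0"
      using z unfolding solvable_coeffs_def laurent_monom_def by blast
    have z_out: "z (i, e) = 0" if "e \<notin> E i" for i e
      using z that by (simp add: solvable_coeffs_def coeff_vectors_def)
    define w where "w j = (case the_inv_into S b j of Inl v \<Rightarrow> z v | Inr k \<Rightarrow> y $ k)" for j
    have w: "w (b (Inr k)) = y $ k" "e \<in> E i \<Longrightarrow> w (b (Inl (i, e))) = z (i, e)" for k i e
    proof -
      have "the_inv_into S b (b (Inr k)) = Inr k"
        by (intro the_inv_into_f_f[OF b]) (simp add: S_def InrI)
      then show "w (b (Inr k)) = y $ k" by (simp add: w_def)
      assume "e \<in> E i"
      then have "the_inv_into S b (b (Inl (i, e))) = Inl (i, e)"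
        by (intro the_inv_into_f_f[OF b]) (simp add: S_def InlI)
      then show "w (b (Inl (i, e))) = z (i, e)" by (simp add: w_def)
    qed
    let ?H0 = "{(Fract N 1, mpoly_eval of_int w N) | N. True} :: (generic_field \<times> complex) set"
    have "partial_hom ?H0"
    proof (rule partial_homI)
      show "(1, 1) \<in> ?H0"
        by (auto simp: One_fract_def ev_int.one intro!: exI[of _ 1])
      fix a b c d assume "(a, b) \<in> ?H0" "(c, d) \<in> ?H0"
      then obtain N N' where [simp]: "a = Fract N 1" "b = mpoly_eval of_int w N"
        "c = Fract N' 1" "d = mpoly_eval of_int w N'" by blast
      show "(a - c, b - d) \<in> ?H0"
        by (auto simp: ev_int.diff intro!: exI[of _ "N - N'"])
      show "(a * c, b * d) \<in> ?H0"
        by (auto simp: ev_int.mult intro!: exI[of _ "N * N'"])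
    next
      fix b assume "(0, b) \<in> ?H0"
      then obtain N where "0 = Fract N 1" "b = mpoly_eval of_int w N" by blast
      then show "b = 0" by (auto simp: Zero_fract_def eq_fract ev_int.zero)
    qed
    \<comment> \<open>\<open>C\<close> involves inverses of the unknowns of the root; the place
      assigns them the expected values, since all \<open>y $ k\<close> are nonzero.\<close>
    from partial_hom_extend_to_place[OF this] obtain H where sub: "?H0 \<subseteq> H" and H: "partial_hom H"
      and inv: "\<And>a b. (a, b) \<in> H \<Longrightarrow> b \<noteq> 0 \<Longrightarrow> (inverse a, inverse b) \<in> H"
      by (elim exE conjE) (rule that, auto)
    have Xw: "(X j, w j) \<in> H" for j
    proof -
      have "(X j, w j) \<in> ?H0" by (auto simp: X_def mpoly_eval_var intro!: exI[of _ "mpoly_var j"])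
      then show ?thesis using sub by blast
    qed
    have "(x $ k, y $ k) \<in> H" for k
      using Xw[of "b (Inr k)"] by (simp add: x_def w(1))
    then have xy: "(laurent_monom x e, laurent_monom y e) \<in> H" for e
      by (intro partial_hom_laurent_monom[OF H inv] y_nz)
    have "(C (i, e), z (i, e)) \<in> H" for i e
    proof -
      consider "e \<notin> E i" | "e \<in> E i" "e \<noteq> e0 i" | "e = e0 i" by blast
      then show ?thesis
      proof cases
        case 1
        then show ?thesis by (simp add: C_def z_out partial_hom_zero[OF H])
      next
        case 2
        then show ?thesis using Xw[of "b (Inl (i, e))"] by (simp add: C_def w)
      next
        case 3
        have "z (i, e0 i) * laurent_monom y (e0 i) = - (\<Sum>e\<in>E i - {e0 i}. z (i, e) * laurent_monom y e)"
          using y[of i] by (simp add: split eq_neg_iff_add_eq_0)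
        then have "z (i, e0 i) = - (\<Sum>e\<in>E i - {e0 i}. z (i, e) * laurent_monom y e) * laurent_monom y (- e0 i)"
          using laurent_monom_nonzero[of y "e0 i"] y_nz
          by (simp add: laurent_monom_uminus field_simps)
        moreover have "(X (b (Inl (i, e))), z (i, e)) \<in> H" if "e \<in> E i - {e0 i}" for e
          using Xw[of "b (Inl (i, e))"] w(2)[of e i] that by simp
        then have "(- (\<Sum>e\<in>E i - {e0 i}. X (b (Inl (i, e))) * laurent_monom x e) * laurent_monom x (- e0 i),
            - (\<Sum>e\<in>E i - {e0 i}. z (i, e) * laurent_monom y e) * laurent_monom y (- e0 i)) \<in> H"
          by (intro partial_hom_mult[OF H] partial_hom_uminus[OF H] partial_hom_sum[OF H] xy)
        ultimately show ?thesis using 3 e0[of i] by (simp add: C_def)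
      qed
    qed
    then have "(mpoly_eval of_int C q, mpoly_eval of_int z q) \<in> H"
      by (intro partial_hom_mpoly_eval[OF H]) auto
    with q show ?thesis using H by (simp add: partial_hom_def)
  qed
  show ?thesis
    using x_nz rel spec by (intro exI[of _ C] exI[of _ x]) (auto simp: C_def)
qed

lemma mpoly_eval_map_of_int:
  fixes c :: "'v \<Rightarrow> complex"
  shows "mpoly_eval (\<lambda>a. a) c (Poly_Mapping.map of_int q) = mpoly_eval of_int c q"
proof -
  have "msupport (Poly_Mapping.map of_int q :: ('v, complex) mpoly) \<subseteq> msupport q"
    by (auto simp: in_keys_iff Poly_Mapping.map.rep_eq when_def)
  then have "mpoly_eval (\<lambda>a. a) c (Poly_Mapping.map of_int q)
      = (\<Sum>m\<in>msupport q. mcoeff (Poly_Mapping.map of_int q) m * mpoly_monom c m)"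
    by (intro mpoly_eval_superset) auto
  then show ?thesis
    by (simp add: mpoly_eval_eq Poly_Mapping.map.rep_eq when_def in_keys_iff)
qed

theorem ex_specialization_place:
  fixes E :: "'i::finite \<Rightarrow> (int ^ 'n::finite) set"
    and c :: "'i \<times> (int ^ 'n) \<Rightarrow> 'k::alg_closed_field"
  assumes fin: "\<And>i. finite (E i)" and ne: "\<And>i. E i \<noteq> {}"
    and vars: "mpoly_vars p \<subseteq> (SIGMA i:UNIV. E i)" and prim: "primitive_mpoly p"
    and closure: "{c \<in> coeff_vectors E. mpoly_eval of_int c p = 0}
      = zariski_closure_in (coeff_vectors E) (solvable_coeffs E)"
    and c_out: "\<forall>i e. e \<notin> E i \<longrightarrow> c (i, e) = 0" and c0: "mpoly_eval of_int c p = 0"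
  shows "\<exists>C (x :: generic_field ^ 'n) H. (\<forall>k. x $ k \<noteq> 0) \<and> partial_hom H \<and>
    (\<forall>i. (\<Sum>e\<in>E i. C (i, e) * laurent_monom x e) = 0) \<and>
    (\<forall>v. (C v, c v) \<in> H) \<and> (\<forall>a. a \<noteq> 0 \<longrightarrow> a \<in> fst ` H \<or> inverse a \<in> fst ` H)"
proof -
  let ?S = "SIGMA i:UNIV. E i"
  obtain C :: "_ \<Rightarrow> generic_field" and x where x: "\<forall>k. x $ k \<noteq> 0"
    and C: "\<forall>i e. e \<notin> E i \<longrightarrow> C (i, e) = 0" "\<forall>i. (\<Sum>e\<in>E i. C (i, e) * laurent_monom x e) = 0"
    and generic: "\<And>q z. z \<in> solvable_coeffs E \<Longrightarrow> mpoly_eval of_int C q = 0 \<Longrightarrow> mpoly_eval of_int z q = 0"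
    using ex_generic_solution[of E, OF fin ne] by blast
  have main: "mpoly_eval of_int c q = 0" if q: "mpoly_eval of_int C q = 0" for q
  proof -
    have van: "mpoly_eval of_int z q = 0" if "z \<in> coeff_vectors E" "mpoly_eval of_int z p = 0" for z :: "_ \<Rightarrow> complex"
    proof -
      have "z \<in> zariski_closure_in (coeff_vectors E) (solvable_coeffs E)"
        using that by (simp flip: closure)
      then show ?thesis
        using generic[OF _ q] unfolding zariski_closure_in_def
        by (auto dest!: spec[of _ "Poly_Mapping.map of_int q"] simp: mpoly_eval_map_of_int)
    qed
    \<comment> \<open>The variables outside the supports are set to 0 in \<open>q\<close>, so that
      vanishing at an arbitrary complex \<open>z\<close> can be tested inside
      \<open>coeff_vectors E\<close>, where \<open>closure\<close> applies.\<close>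
    let ?r = "mpoly_eval of_int (\<lambda>v. if v \<in> ?S then mpoly_var v else 0) q :: (_, int) mpoly"
    have r: "mpoly_eval of_int z ?r = mpoly_eval of_int (\<lambda>v. if v \<in> ?S then z v else 0) q"
      for z :: "_ \<Rightarrow> 'r::comm_ring_1"
      unfolding ev_int.mpoly_eval_int_hom
      by (intro arg_cong2[of _ _ _ _ "mpoly_eval of_int"] refl ext) (simp add: ev_int.zero mpoly_eval_var)
    have "mpoly_eval of_int c ?r = 0"
    proof (rule hypersurface_nullstellensatz[OF prim _ c0])
      fix z :: "_ \<Rightarrow> complex" assume z: "mpoly_eval of_int z p = 0"
      let ?z = "\<lambda>v. if v \<in> ?S then z v else 0"
      have "mpoly_eval of_int ?z p = mpoly_eval of_int z p"
        using vars by (intro mpoly_eval_cong) auto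
      moreover have "?z \<in> coeff_vectors E" by (simp add: coeff_vectors_def)
      ultimately show "mpoly_eval of_int z ?r = 0" using z van[of ?z] by (simp add: r)
    qed
    moreover have "(\<lambda>v. if v \<in> ?S then c v else 0) = c" using c_out by (auto simp: fun_eq_iff)
    ultimately show ?thesis by (simp add: r)
  qed
  let ?G = "{(mpoly_eval of_int C q, mpoly_eval of_int c q) | q. True}"
  have "partial_hom ?G"
  proof (rule partial_homI)
    show "(1, 1) \<in> ?G" by (auto simp: ev_int.one intro!: exI[of _ 1])
    fix a b a' b' assume "(a, b) \<in> ?G" "(a', b') \<in> ?G"
    then obtain q q' where [simp]: "a = mpoly_eval of_int C q" "b = mpoly_eval of_int c q"
      "a' = mpoly_eval of_int C q'" "b' = mpoly_eval of_int c q'" by blast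
    show "(a - a', b - b') \<in> ?G" by (auto simp: ev_int.diff intro!: exI[of _ "q - q'"])
    show "(a * a', b * b') \<in> ?G" by (auto simp: ev_int.mult intro!: exI[of _ "q * q'"])
  next
    fix b assume "(0, b) \<in> ?G"
    then obtain q where "0 = mpoly_eval of_int C q" "b = mpoly_eval of_int c q" by blast
    then show "b = 0" using main[of q] by simp
  qed
  from partial_hom_extend_to_place[OF this] obtain H where sub: "?G \<subseteq> H"
    and H: "partial_hom H" "\<forall>a. a \<noteq> 0 \<longrightarrow> a \<in> fst ` H \<or> inverse a \<in> fst ` H"
    by (elim exE conjE) (rule that, auto)
  have "(C v, c v) \<in> ?G" for v
    by (auto simp: mpoly_eval_var intro!: exI[of _ "mpoly_var v"])
  with sub have "(C v, c v) \<in> H" for v by blast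
  then show ?thesis using x C(2) H by (intro exI[of _ C] exI[of _ x] exI[of _ H]) simp
qed

section \<open>Faces and normal cones of polytopes\<close>

lemma polytope_set_sum:
  assumes "\<And>i. i \<in> I \<Longrightarrow> polytope (Q i)"
  shows "polytope (\<Sum>i\<in>I. Q i)"
proof -
  from assms have "\<forall>i\<in>I. \<exists>V. finite V \<and> Q i = convex hull V" by (simp add: polytope_def)
  then obtain V where V: "\<And>i. i \<in> I \<Longrightarrow> finite (V i)" "\<And>i. i \<in> I \<Longrightarrow> Q i = convex hull (V i)"
    by metis
  have "(\<Sum>i\<in>I. Q i) = convex hull (\<Sum>i\<in>I. V i)"
    by (simp add: V(2) convex_hull_set_sum)
  moreover have "finite (\<Sum>i\<in>I. V i)" using V(1) by (intro finite_set_sum) simp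
  ultimately show ?thesis unfolding polytope_def by blast
qed

lemma face_in_direction_nonempty:
  assumes "compact P" "P \<noteq> {}"
  shows "face_in_direction P w \<noteq> {}"
proof -
  have "continuous_on P (\<lambda>x. w \<bullet> x)" by (intro continuous_intros)
  from continuous_attains_inf[OF assms this] show ?thesis
    by (auto simp: face_in_direction_def)
qed

lemma face_in_direction_face_of:
  assumes "convex P"
  shows "face_in_direction P w face_of P"
proof (cases "face_in_direction P w = {}")
  case True
  then show ?thesis by simp
next
  case False
  then obtain x where x: "x \<in> P" "\<And>y. y \<in> P \<Longrightarrow> w \<bullet> x \<le> w \<bullet> y"
    by (auto simp: face_in_direction_def)
  have "face_in_direction P w = P \<inter> {y. w \<bullet> y = w \<bullet> x}"
    using x by (auto simp: face_in_direction_def intro: antisym)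
  then show ?thesis
    using face_of_Int_supporting_hyperplane_ge[OF assms, of "w \<bullet> x" w] x(2) by simp
qed

text \<open>At the common minimizer \<open>x\<close> both minima are attained, so a minimizer of the
  sum has to attain both.\<close>

lemma face_in_direction_add:
  assumes x: "x \<in> face_in_direction P w" "x \<in> face_in_direction P v"
  shows "face_in_direction P (w + v) = face_in_direction P w \<inter> face_in_direction P v"
proof (intro antisym subsetI)
  fix y assume y: "y \<in> face_in_direction P (w + v)"
  then have "y \<in> P" by (simp add: face_in_direction_def)
  with x have le: "w \<bullet> x \<le> w \<bullet> y" "v \<bullet> x \<le> v \<bullet> y" by (auto simp: face_in_direction_def)
  moreover have "w \<bullet> y + v \<bullet> y \<le> w \<bullet> x + v \<bullet> x"
    using x y by (simp add: face_in_direction_def inner_add_left)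
  ultimately have "w \<bullet> y = w \<bullet> x" "v \<bullet> y = v \<bullet> x" by linarith+
  with x \<open>y \<in> P\<close> show "y \<in> face_in_direction P w \<inter> face_in_direction P v"
    by (simp add: face_in_direction_def)
qed (auto simp: face_in_direction_def inner_add_left intro: add_mono)

lemma face_in_direction_scaleR:
  assumes "c > 0"
  shows "face_in_direction P (c *\<^sub>R w) = face_in_direction P w"
  using assms by (simp add: face_in_direction_def)

text \<open>The right-hand side is an intersection of half-spaces, hence a closed convex cone.
  Conversely, for \<open>v\<close> in it, \<open>v + \<epsilon> *\<^sub>R w\<close> has exactly the
  face of \<open>w\<close> and tends to \<open>v\<close>.\<close>

lemma normal_cone_of_face_eq:
  assumes "compact P" "P \<noteq> {}"
  shows "normal_cone_of_face P w = {v. face_in_direction P w \<subseteq> face_in_direction P v}"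
    (is "_ = ?N")
proof
  have N: "?N = (\<Inter>x\<in>face_in_direction P w. \<Inter>y\<in>P. {v. v \<bullet> x \<le> v \<bullet> y})"
    by (auto simp: face_in_direction_def)
  have "closed ?N"
    unfolding N by (intro closed_INT ballI closed_Collect_le continuous_intros)
  moreover have "convex_cone hull {w'. face_in_direction P w' = face_in_direction P w} \<subseteq> ?N"
  proof (rule hull_minimal)
    show "convex_cone ?N"
      unfolding convex_cone_iff N
      by (auto simp: inner_add_left intro: add_mono mult_left_mono)
  qed auto
  ultimately show "normal_cone_of_face P w \<subseteq> ?N"
    unfolding normal_cone_of_face_def by (rule closure_minimal[rotated])
next
  show "?N \<subseteq> normal_cone_of_face P w"
  proof
    fix v assume v: "v \<in> ?N"
    obtain x where x: "x \<in> face_in_direction P w" using face_in_direction_nonempty[OF assms] by blast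
    have mem: "v + \<epsilon> *\<^sub>R w \<in> convex_cone hull {w'. face_in_direction P w' = face_in_direction P w}"
      if "\<epsilon> > 0" for \<epsilon>
    proof (rule hull_inc)
      show "v + \<epsilon> *\<^sub>R w \<in> {w'. face_in_direction P w' = face_in_direction P w}"
        using v x that face_in_direction_add[of x P v "\<epsilon> *\<^sub>R w"] by (auto simp: face_in_direction_scaleR)
    qed
    show "v \<in> normal_cone_of_face P w"
      unfolding normal_cone_of_face_def closure_approachable
    proof (intro allI impI)
      fix e :: real assume "e > 0"
      define \<epsilon> where "\<epsilon> = e / (2 * (norm w + 1))"
      have "\<epsilon> > 0" using \<open>e > 0\<close> by (simp add: \<epsilon>_def add_nonneg_pos)
      have "dist (v + \<epsilon> *\<^sub>R w) v = \<epsilon> * norm w" using \<open>\<epsilon> > 0\<close> by (simp add: dist_norm)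
      also have "\<dots> < \<epsilon> * (2 * (norm w + 1))"
        using \<open>\<epsilon> > 0\<close> by (intro mult_strict_left_mono) (simp_all add: add_nonneg_pos)
      also have "\<dots> = e" by (simp add: \<epsilon>_def add_nonneg_eq_0_iff)
      finally show "\<exists>y\<in>convex_cone hull {w'. face_in_direction P w' = face_in_direction P w}. dist y v < e"
        using mem[OF \<open>\<epsilon> > 0\<close>] by blast
    qed
  qed
qed

lemma finite_faces_in_direction:
  assumes "polytope P"
  shows "finite (range (face_in_direction P))"
  by (rule finite_subset[OF _ finite_polytope_faces[OF assms]])
    (auto intro: face_in_direction_face_of polytope_imp_convex assms)

lemma finite_Fan:
  assumes "polytope P"
  shows "finite (Fan P)"
proof -
  have "Fan P = (\<lambda>F. closure (convex_cone hull {w'. face_in_direction P w' = F})) ` range (face_in_direction P)"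
    by (auto simp: Fan_def normal_cone_of_face_def)
  then show ?thesis using finite_faces_in_direction[OF assms] by simp
qed

text \<open>Choose \<open>w\<close> with minimal face among those containing \<open>s\<close>.
  Adding a \<open>v\<close> minimized at \<open>s\<close> intersects the two faces, so by minimality
  the face of \<open>w\<close> lies in that of \<open>v\<close>.\<close>

lemma ex_cone_of_point:
  assumes P: "polytope P" and s: "s \<in> P"
  shows "\<exists>\<sigma>\<in>Fan P. \<forall>v. s \<in> face_in_direction P v \<longrightarrow> v \<in> \<sigma>"
proof -
  let ?W = "{w. s \<in> face_in_direction P w}"
  have "0 \<in> ?W" using s by (simp add: face_in_direction_def)
  moreover have "finite (face_in_direction P ` ?W)"
    by (rule finite_subset[OF _ finite_faces_in_direction[OF P]]) auto
  ultimately obtain F where "F \<in> face_in_direction P ` ?W"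
    "\<forall>F'\<in>face_in_direction P ` ?W. F' \<subseteq> F \<longrightarrow> F = F'"
    using finite_has_minimal[of "face_in_direction P ` ?W"] by blast
  then obtain w where w: "s \<in> face_in_direction P w"
    and min: "\<And>v. s \<in> face_in_direction P v \<Longrightarrow> face_in_direction P v \<subseteq> face_in_direction P w
      \<Longrightarrow> face_in_direction P v = face_in_direction P w"
    by auto
  have "v \<in> normal_cone_of_face P w" if v: "s \<in> face_in_direction P v" for v
  proof -
    have "face_in_direction P (w + v) = face_in_direction P w \<inter> face_in_direction P v"
      by (rule face_in_direction_add[OF w v])
    with min[of "w + v"] w v have "face_in_direction P w \<subseteq> face_in_direction P v" by auto
    then show ?thesis
      using normal_cone_of_face_eq[of P w] P s polytope_imp_compact by auto
  qed
  then show ?thesis by (auto simp: Fan_def)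
qed

section \<open>Total orders on the character lattice\<close>

definition int_dot :: "int ^ 'n::finite \<Rightarrow> int ^ 'n \<Rightarrow> int"
  where "int_dot w d = (\<Sum>k\<in>UNIV. w $ k * d $ k)"

lemma int_dot_add_right: "int_dot w (a + b) = int_dot w a + int_dot w b"
  by (simp add: int_dot_def algebra_simps sum.distrib)

lemma int_dot_add_left: "int_dot (v + w) a = int_dot v a + int_dot w a"
  by (simp add: int_dot_def algebra_simps sum.distrib)

lemma int_dot_scale_right: "int_dot w (c *s a) = c * int_dot w a"
  by (simp add: int_dot_def sum_distrib_left algebra_simps)

lemma int_dot_scale_left: "int_dot (c *s w) a = c * int_dot w a"
  by (simp add: int_dot_def sum_distrib_left algebra_simps)

lemma inner_real_vec: "real_vec w \<bullet> real_vec d = real_of_int (int_dot w d)"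
  by (simp add: real_vec_def int_dot_def inner_vec_def)

lemma real_vec_0 [simp]: "real_vec 0 = 0"
  by (simp add: real_vec_def vec_eq_iff)

lemma real_vec_add: "real_vec (a + b) = real_vec a + real_vec b"
  by (simp add: real_vec_def vec_eq_iff)

lemma real_vec_diff: "real_vec (a - b) = real_vec a - real_vec b"
  by (simp add: real_vec_def vec_eq_iff)

text \<open>The nonnegative elements of a total preorder compatible with addition. Both
  \<open>a\<close> and \<open>- a\<close> may lie in \<open>T\<close>, as happens for characters
  whose values are units of the valuation ring.\<close>

locale total_submonoid =
  fixes T :: "(int ^ 'n::finite) set"
  assumes zero: "0 \<in> T"
    and add: "a \<in> T \<Longrightarrow> b \<in> T \<Longrightarrow> a + b \<in> T"
    and total: "a \<in> T \<or> - a \<in> T"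
begin

lemma scale: "0 \<le> c \<Longrightarrow> a \<in> T \<Longrightarrow> c *s a \<in> T"
  by (induction c rule: int_ge_induct) (auto simp: zero add vector_sadd_rdistrib)

lemma scale_cancel:
  assumes "0 < c" "c *s a \<in> T"
  shows "a \<in> T"
proof (rule ccontr)
  assume "a \<notin> T"
  then have "(c - 1) *s (- a) \<in> T" using total assms(1) by (intro scale) auto
  with assms(2) have "c *s a + (c - 1) *s (- a) \<in> T" by (rule add)
  moreover have "c *s a + (c - 1) *s (- a) = a" by (simp add: vec_eq_iff algebra_simps)
  ultimately show False using \<open>a \<notin> T\<close> by simp
qed

text \<open>An integral form of Farkas' lemma. In the induction step, the vectors are projected along
  \<open>d\<close> to the hyperplane orthogonal to \<open>w\<close>.\<close>

lemma ex_separating_functional: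
  assumes "set ds \<subseteq> T" "e \<notin> T"
  shows "\<exists>w. (\<forall>d\<in>set ds. 0 \<le> int_dot w d) \<and> int_dot w e < 0"
  using assms
proof (induction "length ds" arbitrary: ds e)
  case 0
  have "e \<noteq> 0" using 0 zero by auto
  then obtain k where "e $ k \<noteq> 0" by (auto simp: vec_eq_iff)
  then have "0 < (\<Sum>k\<in>UNIV. e $ k * e $ k)"
    by (intro sum_pos2[of _ k]) (auto simp: zero_less_mult_iff)
  then have "int_dot (- e) e < 0" by (simp add: int_dot_def sum_negf)
  then show ?case using 0 by auto
next
  case (Suc n)
  then obtain d ds' where ds: "ds = d # ds'" "n = length ds'" by (cases ds) auto
  with Suc.hyps(1)[of ds' e] Suc.prems obtain w where
    w: "\<And>d'. d' \<in> set ds' \<Longrightarrow> 0 \<le> int_dot w d'" "int_dot w e < 0" by auto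
  show ?case
  proof (cases "0 \<le> int_dot w d")
    case True
    then show ?thesis using w ds by auto
  next
    case False
    define \<alpha> where "\<alpha> = - int_dot w d"
    have \<alpha>: "\<alpha> > 0" using False by (simp add: \<alpha>_def)
    define pr where "pr v = \<alpha> *s v + int_dot w v *s d" for v
    have d: "d \<in> T" using Suc.prems ds by simp
    have "set (map pr ds') \<subseteq> T"
      using Suc.prems(1) ds w(1) \<alpha> d by (auto simp: pr_def intro!: add scale)
    \<comment> \<open>Adding \<open>- int_dot w e\<close> times \<open>d\<close>, a positive
      multiple by the choice of \<open>w\<close>, would bring \<open>\<alpha> *s e\<close> into
      \<open>T\<close>.\<close>
    moreover have "pr e \<notin> T"
    proof
      assume "pr e \<in> T"
      moreover have "(- int_dot w e) *s d \<in> T" using w(2) d by (intro scale) auto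
      ultimately have "pr e + (- int_dot w e) *s d \<in> T" by (rule add)
      then have "\<alpha> *s e \<in> T" by (simp add: pr_def vector_smult_lneg)
      then show False using scale_cancel \<alpha> Suc.prems(2) by blast
    qed
    ultimately obtain w' where w': "\<And>d'. d' \<in> set ds' \<Longrightarrow> 0 \<le> int_dot w' (pr d')" "int_dot w' (pr e) < 0"
      using Suc.hyps(1)[of "map pr ds'" "pr e"] ds(2) by auto
    \<comment> \<open>This is \<open>w'\<close> composed with \<open>pr\<close>; it vanishes on
      \<open>d\<close> because \<open>pr d = 0\<close>.\<close>
    define w'' where "w'' = \<alpha> *s w' + int_dot w' d *s w"
    have "int_dot w'' v = int_dot w' (pr v)" for v
      by (simp add: w''_def pr_def int_dot_add_left int_dot_add_right int_dot_scale_left int_dot_scale_right)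
    moreover have "int_dot w'' d = 0"
      by (simp add: w''_def \<alpha>_def int_dot_add_left int_dot_scale_left)
    ultimately show ?thesis using w' ds by (intro exI[of _ w'']) auto
  qed
qed

lemma ex_least_element:
  assumes "finite S" "S \<noteq> {}"
  shows "\<exists>s\<in>S. \<forall>a\<in>S. a - s \<in> T"
  using assms
proof (induction S rule: finite_ne_induct)
  case (singleton a)
  then show ?case using zero by simp
next
  case (insert b S)
  then obtain s where s: "s \<in> S" "\<And>a. a \<in> S \<Longrightarrow> a - s \<in> T" by blast
  show ?case
  proof (cases "b - s \<in> T")
    case True
    then show ?thesis using s by auto
  next
    case False
    then have "s - b \<in> T" using total[of "b - s"] by simp
    then have "a - b \<in> T" if "a \<in> S" for a
      using add[OF s(2)[OF that], of "s - b"] by simp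
    then show ?thesis using zero by auto
  qed
qed

text \<open>This is the completeness of the toric variety. The least elements \<open>s i\<close> add
  up to a point \<open>s0\<close> of the polytope, and the cone contains all functionals minimized
  at \<open>s0\<close>. Some such functional is negative on any given \<open>e\<close> outside
  \<open>T\<close>, which keeps \<open>e\<close> out of the dual monoid.\<close>

lemma ex_cone_dual_monoid_subset:
  fixes E :: "'i::finite \<Rightarrow> (int ^ 'n) set"
  assumes fin: "\<And>i. finite (E i)" and ne: "\<And>i. E i \<noteq> {}"
  shows "\<exists>\<sigma>\<in>Fan (\<Sum>i\<in>UNIV. Conv (E i)). dual_monoid \<sigma> \<subseteq> T"
proof -
  let ?P = "\<Sum>i\<in>UNIV. Conv (E i)"
  obtain s where s: "\<And>i. s i \<in> E i" "\<And>i a. a \<in> E i \<Longrightarrow> a - s i \<in> T"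
    using ex_least_element[OF fin ne] by metis
  define s0 where "s0 = (\<Sum>i\<in>UNIV. real_vec (s i))"
  have s_Conv: "real_vec (s i) \<in> Conv (E i)" for i
    unfolding Conv_def using s(1) by (intro hull_inc) auto
  have "polytope (Conv (E i))" for i
    unfolding polytope_def Conv_def using fin[of i] by blast
  then have P: "polytope ?P" by (intro polytope_set_sum)
  have s0: "s0 \<in> ?P" unfolding s0_def set_sum_alt[OF finite] using s_Conv by blast
  obtain \<sigma> where \<sigma>: "\<sigma> \<in> Fan ?P" "\<And>v. s0 \<in> face_in_direction ?P v \<Longrightarrow> v \<in> \<sigma>"
    using ex_cone_of_point[OF P s0] by blast
  have "e \<in> T" if e: "e \<in> dual_monoid \<sigma>" for e
  proof (rule ccontr)
    assume "e \<notin> T"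
    have "finite (\<Union>i. (\<lambda>a. a - s i) ` E i)" using fin by auto
    from finite_list[OF this] obtain ds where ds: "set ds = (\<Union>i. (\<lambda>a. a - s i) ` E i)"
      by (rule exE)
    have "set ds \<subseteq> T" unfolding ds using s(2) by auto
    from ex_separating_functional[OF this \<open>e \<notin> T\<close>] obtain w
      where w: "\<And>d. d \<in> set ds \<Longrightarrow> 0 \<le> int_dot w d" "int_dot w e < 0" by blast
    have ge: "real_vec w \<bullet> real_vec (s i) \<le> real_vec w \<bullet> q" if "q \<in> Conv (E i)" for q i
    proof -
      have "Conv (E i) \<subseteq> {q. real_vec w \<bullet> real_vec (s i) \<le> real_vec w \<bullet> q}"
        unfolding Conv_def
      proof (intro hull_minimal)
        show "convex {q. real_vec w \<bullet> real_vec (s i) \<le> real_vec w \<bullet> q}"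
          using convex_halfspace_ge[of "real_vec w \<bullet> real_vec (s i)" "real_vec w"] by simp
        show "real_vec ` E i \<subseteq> {q. real_vec w \<bullet> real_vec (s i) \<le> real_vec w \<bullet> q}"
        proof
          fix q assume "q \<in> real_vec ` E i"
          then obtain a where a: "a \<in> E i" "q = real_vec a" by blast
          have "0 \<le> int_dot w (a - s i)" using a(1) ds by (intro w(1)) auto
          then have "0 \<le> real_vec w \<bullet> real_vec (a - s i)" by (simp add: inner_real_vec)
          then show "q \<in> {q. real_vec w \<bullet> real_vec (s i) \<le> real_vec w \<bullet> q}"
            by (simp add: a(2) real_vec_diff inner_diff_right)
        qed
      qed
      then show ?thesis using that by blast
    qed
    have "real_vec w \<bullet> s0 \<le> real_vec w \<bullet> y" if y: "y \<in> ?P" for y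
    proof -
      obtain q where q: "y = (\<Sum>i\<in>UNIV. q i)" "\<And>i. q i \<in> Conv (E i)"
        using y unfolding set_sum_alt[OF finite] by auto
      show ?thesis unfolding q(1) s0_def inner_sum_right using ge q(2) by (intro sum_mono) auto
    qed
    then have "real_vec w \<in> \<sigma>" using s0 by (intro \<sigma>(2)) (simp add: face_in_direction_def)
    then have "0 \<le> real_vec w \<bullet> real_vec e" using e by (simp add: dual_monoid_def dual_cone_def)
    then show False using w(2) by (simp add: inner_real_vec)
  qed
  then show ?thesis using \<sigma>(1) by blast
qed

end

section \<open>Compatibility and divisibility among the vertex monomials\<close>

lemma product_of_simplices_polytope:
  assumes "product_of_simplices B"
  shows "polytope B"
proof -
  obtain k :: nat and L t S where "\<forall>j<k. \<exists>d. int d simplex S j \<and> S j \<subseteq> (\<lambda>x. t j + x) ` L j"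
    and B: "B = (\<Sum>j<k. S j)"
    using assms unfolding product_of_simplices_def by blast
  then have "polytope (S j)" if "j < k" for j using that simplex_imp_polytope by blast
  then show ?thesis unfolding B by (intro polytope_set_sum) auto
qed

text \<open>Compatibility places \<open>\<sigma>\<close> inside a normal cone of \<open>B\<close>,
  so all functionals in \<open>\<sigma>\<close> attain their minimum over \<open>B\<close> at one
  common vertex.\<close>

lemma ex_vertex_minimal_on_cone:
  assumes P: "polytope P" "P \<noteq> {}" and B: "polytope B" "B \<noteq> {}"
    and compat: "compatible_with P B" and A: "real_vec ` A = {v. v extreme_point_of B}"
    and \<sigma>: "\<sigma> \<in> Fan P"
  shows "\<exists>a\<in>A. \<forall>a'\<in>A. a' - a \<in> dual_monoid \<sigma>"
proof -
  have cP: "compact P" and cB: "compact B" and B_conv: "convex B"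
    using P B polytope_imp_compact polytope_imp_convex by blast+
  note nP = normal_cone_of_face_eq[OF cP P(2)] and nB = normal_cone_of_face_eq[OF cB B(2)]
  obtain w where w: "\<sigma> = normal_cone_of_face P w" using \<sigma> by (auto simp: Fan_def)
  let ?\<tau> = "normal_cone_of_face B w"
  have "?\<tau> \<in> Fan B" by (auto simp: Fan_def)
  then obtain \<C> where \<C>: "\<C> \<subseteq> Fan P" "?\<tau> = \<Union>\<C>" using compat unfolding compatible_with_def by blast
  have "w \<in> ?\<tau>" by (simp add: nB)
  then obtain \<sigma>' where \<sigma>': "\<sigma>' \<in> \<C>" "w \<in> \<sigma>'" using \<C> by blast
  then obtain w' where w': "\<sigma>' = normal_cone_of_face P w'" using \<C>(1) by (auto simp: Fan_def)
  \<comment> \<open>\<open>\<sigma>\<close> is the smallest cone of the fan that contains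
    \<open>w\<close>.\<close>
  have "\<sigma> \<subseteq> \<sigma>'" using \<sigma>'(2) unfolding w w' nP by auto
  then have sub: "\<sigma> \<subseteq> ?\<tau>" using \<sigma>'(1) \<C>(2) by blast
  let ?F = "face_in_direction B w"
  have F: "?F face_of B" by (rule face_in_direction_face_of[OF B_conv])
  have "?F = convex hull {x. x extreme_point_of ?F}"
    using face_of_imp_compact[OF B_conv cB F] face_of_imp_convex[OF F] by (rule Krein_Milman_Minkowski)
  moreover have "?F \<noteq> {}" by (rule face_in_direction_nonempty[OF cB B(2)])
  ultimately obtain x where "x extreme_point_of ?F" by (metis Collect_empty_eq convex_hull_empty)
  then have "x extreme_point_of B" "x \<in> ?F" using extreme_point_of_face[OF F] by auto
  then obtain a where a: "a \<in> A" "x = real_vec a" using A by blast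
  have "a' - a \<in> dual_monoid \<sigma>" if "a' \<in> A" for a'
  proof -
    have "real_vec a' \<in> B" using A that by (auto simp: extreme_point_of_def)
    then have "0 \<le> v \<bullet> real_vec (a' - a)" if "v \<in> \<sigma>" for v
      using that sub \<open>x \<in> ?F\<close> a(2)
      by (auto simp: nB face_in_direction_def real_vec_diff inner_diff_right)
    then show ?thesis by (simp add: dual_monoid_def dual_cone_def)
  qed
  then show ?thesis using a(1) by blast
qed

section \<open>Nonvanishing of the twisted Chow form\<close>

text \<open>Over a finite field, 1 plus the product of all \<open>X - a\<close> would have no
  root.\<close>

lemma infinite_UNIV_alg_closed_field: "infinite (UNIV :: 'k::alg_closed_field set)"
proof
  assume fin: "finite (UNIV :: 'k set)"
  define q where "q = (\<Prod>a\<in>UNIV. [:- a, 1 :: 'k:])"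
  have "degree q = card (UNIV :: 'k set)"
    unfolding q_def by (subst degree_prod_eq_sum_degree) auto
  also have "\<dots> > 0" using fin by (simp add: card_gt_0_iff)
  finally have "degree (q + 1) > 0" by (subst degree_add_eq_left) auto
  then obtain z where "poly (q + 1) z = 0" using alg_closed_imp_poly_has_root by blast
  moreover have "poly q z = 0" unfolding q_def poly_prod using fin by (intro prod_zero) auto
  ultimately show False by simp
qed

text \<open>A point of the toric variety has at most one representative in each of the finitely many
  charts: glued points over the same cone restrict the same \<open>\<delta>\<close>.\<close>

lemma finite_chart_roots:
  assumes Fan: "finite (Fan P)" and roots: "finite (toric_roots P E F)"
  shows "finite {(\<sigma>, \<gamma>). \<sigma> \<in> Fan P \<and> \<gamma> \<in> chart_points \<sigma> \<and> chart_root E F \<sigma> \<gamma>}"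
    (is "finite ?R")
proof -
  let ?f = "\<lambda>x. (fst x, toric_gluing P `` {x})"
  have refl: "x \<in> toric_gluing P `` {x}" if xR: "x \<in> ?R" for x
  proof -
    obtain \<sigma> \<gamma> where x: "x = (\<sigma>, \<gamma>)" "\<sigma> \<in> Fan P" "\<gamma> \<in> chart_points \<sigma>" using xR by blast
    then have "restrict_point \<sigma> \<gamma> = \<gamma>" by (auto simp: restrict_point_def chart_points_def)
    then show ?thesis using x by (auto simp: toric_gluing_def intro!: bexI[of _ \<gamma>])
  qed
  have "inj_on ?f ?R"
  proof (rule inj_onI)
    fix x y assume x: "x \<in> ?R" and y: "y \<in> ?R" and eq: "?f x = ?f y"
    then have "(x, y) \<in> toric_gluing P" using refl[OF y] by auto
    then have "snd x = snd y" using eq by (auto simp: toric_gluing_def)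
    with eq show "x = y" by (simp add: prod_eq_iff)
  qed
  moreover have "?f ` ?R \<subseteq> Fan P \<times> toric_roots P E F"
  proof
    fix z assume "z \<in> ?f ` ?R"
    then obtain x where x: "x \<in> ?R" "z = ?f x" by blast
    obtain \<sigma> \<gamma> where \<sigma>: "x = (\<sigma>, \<gamma>)" "\<sigma> \<in> Fan P" "\<gamma> \<in> chart_points \<sigma>" "chart_root E F \<sigma> \<gamma>"
      using x(1) by blast
    then have "toric_gluing P `` {x} \<in> toric_variety P"
      unfolding toric_variety_def by (intro quotientI) simp
    moreover have "\<exists>(\<sigma>, \<gamma>)\<in>toric_gluing P `` {x}. chart_root E F \<sigma> \<gamma>"
      using refl[OF x(1)] \<sigma>(4) unfolding \<sigma>(1) by (intro bexI[of _ "(\<sigma>, \<gamma>)"]) simp_all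
    ultimately show "z \<in> Fan P \<times> toric_roots P E F"
      using x(2) \<sigma>(1,2) by (simp add: toric_roots_def)
  qed
  ultimately show ?thesis
    by (rule inj_on_finite) (intro finite_cartesian_product Fan roots)
qed

lemma mpoly_eval_twisted_chow_form:
  fixes F :: "'n::finite \<Rightarrow> ('n, 'k::comm_ring_1) laurent"
  assumes "finite A"
  shows "mpoly_eval (\<lambda>a. a) u (twisted_chow_form R F A)
    = mpoly_eval of_int (\<lambda>(i, e). append_entry (\<lambda>j. mcoeff (F j) e) (if e \<in> A then u e else 0) i) R"
proof -
  interpret ev: ring_hom_fun "mpoly_eval (\<lambda>a :: 'k. a) u"
    by (rule ring_hom_fun_mpoly_eval[OF ring_hom_fun_id])
  have "mpoly_eval (\<lambda>a. a) u
      (mcoeff (append_entry (\<lambda>i. Poly_Mapping.map mpoly_const (F i)) (generic_laurent A) i) e)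
    = append_entry (\<lambda>j. mcoeff (F j) e) (if e \<in> A then u e else 0) i" for i e
  proof (cases i)
    case None
    have "mcoeff (generic_laurent A) e = (if e \<in> A then (mpoly_var e :: (int ^ 'n, 'k) mpoly) else 0)"
      using assms by (simp add: generic_laurent_def lookup_sum lookup_single when_def)
    then show ?thesis using None by (simp add: append_entry_def mpoly_eval_var ev.zero)
  next
    case (Some j)
    then show ?thesis
      by (auto simp: append_entry_def Poly_Mapping.map.rep_eq when_def mpoly_eval_const ev.zero)
  qed
  then show ?thesis
    unfolding twisted_chow_form_def resultant_at_def ev.mpoly_eval_int_hom
    by (intro arg_cong2[of _ _ _ _ "mpoly_eval of_int"] refl ext) (simp add: case_prod_beta)
qed

text \<open>The place yields a total preorder on the characters, by integrality of their values at the
  generic root; a cone on whose dual monoid all characters are integral is a chart to which the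
  generic root specializes.\<close>

lemma ex_chart_point_of_place:
  fixes E :: "'i::finite \<Rightarrow> (int ^ 'n::finite) set" and x :: "'a::field ^ 'n"
    and H :: "('a \<times> 'k::field) set"
  assumes fin: "\<And>i. finite (E i)" and ne: "\<And>i. E i \<noteq> {}"
    and x: "\<And>k. x $ k \<noteq> 0" and H: "partial_hom H"
    and total: "\<And>a. a \<noteq> 0 \<Longrightarrow> a \<in> fst ` H \<or> inverse a \<in> fst ` H"
  shows "\<exists>\<sigma>\<in>Fan (\<Sum>i\<in>UNIV. Conv (E i)). \<exists>\<gamma>\<in>chart_points \<sigma>.
    \<forall>e\<in>dual_monoid \<sigma>. (laurent_monom x e, \<gamma> e) \<in> H"
proof -
  define T where "T = {e. \<exists>b. (laurent_monom x e, b) \<in> H}"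
  interpret total_submonoid T
  proof
    show "0 \<in> T" using partial_hom_one[OF H] by (auto simp: T_def)
    show "a + b \<in> T" if "a \<in> T" "b \<in> T" for a b
      using that partial_hom_mult[OF H] by (force simp: T_def laurent_monom_add x)
    show "a \<in> T \<or> - a \<in> T" for a
      using total[of "laurent_monom x a"] laurent_monom_nonzero[OF x]
      by (force simp: T_def laurent_monom_uminus)
  qed
  obtain \<sigma> where \<sigma>: "\<sigma> \<in> Fan (\<Sum>i\<in>UNIV. Conv (E i))" "dual_monoid \<sigma> \<subseteq> T"
    using ex_cone_dual_monoid_subset[of E, OF fin ne] by blast
  \<comment> \<open>The choice is unique, as \<open>H\<close> is single-valued; the value 0 off the
    dual monoid is the normal form demanded by \<open>chart_points\<close>.\<close>
  define \<gamma> where "\<gamma> e = (if e \<in> dual_monoid \<sigma> then SOME b. (laurent_monom x e, b) \<in> H else 0)" for e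
  have \<gamma>: "(laurent_monom x e, \<gamma> e) \<in> H" if "e \<in> dual_monoid \<sigma>" for e
  proof -
    have "\<exists>b. (laurent_monom x e, b) \<in> H" using that \<sigma>(2) by (auto simp: T_def)
    from someI_ex[OF this] show ?thesis using that by (simp add: \<gamma>_def)
  qed
  have add_mem: "a + b \<in> dual_monoid \<sigma>" if "a \<in> dual_monoid \<sigma>" "b \<in> dual_monoid \<sigma>" for a b
    using that by (simp add: dual_monoid_def dual_cone_def real_vec_add inner_add_right)
  have zero_mem: "0 \<in> dual_monoid \<sigma>" by (simp add: dual_monoid_def dual_cone_def)
  have "\<gamma> \<in> chart_points \<sigma>"
  proof -
    have "\<gamma> 0 = 1"
      using partial_hom_single_valued[OF H \<gamma>[OF zero_mem]] partial_hom_one[OF H] by simp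
    moreover have "\<gamma> (a + b) = \<gamma> a * \<gamma> b" if "a \<in> dual_monoid \<sigma>" "b \<in> dual_monoid \<sigma>" for a b
      using partial_hom_single_valued[OF H \<gamma>[OF add_mem[OF that]]]
        partial_hom_mult[OF H \<gamma>[OF that(1)] \<gamma>[OF that(2)]] by (simp add: laurent_monom_add x)
    ultimately show ?thesis by (simp add: chart_points_def \<gamma>_def)
  qed
  then show ?thesis using \<sigma>(1) \<gamma> by blast
qed

theorem mainTheorem2:
  fixes E :: "'n::finite \<Rightarrow> (int ^ 'n) set"
    and F :: "'n \<Rightarrow> ('n, 'k::alg_closed_field) laurent"
    and P B :: "(real ^ 'n) set"
    and A :: "(int ^ 'n) set"
    and R :: "('n option \<times> (int ^ 'n), int) mpoly"
  assumes "\<And>i. finite (E i)" and "\<And>i. E i \<noteq> {}"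
    and "mixed_volume UNIV (\<lambda>i. Conv (E i)) > 0"
    and "\<And>i. Poly_Mapping.keys (F i) \<subseteq> E i"
    and "P = (\<Sum>i\<in>UNIV. Conv (E i))"
    and "product_of_simplices B"
    and "compatible_with P B"
    and "real_vec ` A = {v. v extreme_point_of B}"
    and "card A \<ge> 2"
    and "is_sparse_resultant (append_entry E A) R"
    and "finite (toric_roots P E F)"
  shows "twisted_chow_form R F A \<noteq> 0"
proof
  assume Ch: "twisted_chow_form R F A = 0"
  let ?E = "append_entry E A"
  have A: "finite A" "A \<noteq> {}" using assms(9) card.infinite by fastforce+
  have E': "finite (?E i)" "?E i \<noteq> {}" for i
    using assms(1,2) A by (auto simp: append_entry_def split: option.splits)
  have "polytope (Conv (E i))" for i
    unfolding polytope_def Conv_def using assms(1)[of i] by blast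
  then have P: "polytope P" unfolding assms(5) by (intro polytope_set_sum)
  have B: "polytope B" by (rule product_of_simplices_polytope[OF assms(6)])
  have "B \<noteq> {}" using A(2) assms(8) by (force simp: extreme_point_of_def)
  define Rt where "Rt = {(\<sigma>, \<gamma>). \<sigma> \<in> Fan P \<and> \<gamma> \<in> chart_points \<sigma> \<and> chart_root E F \<sigma> \<gamma>}"
  have Rt: "finite Rt" unfolding Rt_def by (rule finite_chart_roots[OF finite_Fan[OF P] assms(11)])
  obtain idx :: "int ^ 'n \<Rightarrow> nat" where idx: "inj_on idx A"
    using finite_imp_inj_to_nat_seg[OF A(1)] by blast
  define L where "L = (\<lambda>((\<sigma>, \<gamma>), a) a'. \<gamma> (a' - a)) ` (Rt \<times> A)"
  have "finite L" unfolding L_def using Rt A(1) by simp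
  moreover have "\<exists>a'\<in>A. l a' \<noteq> 0" if l: "l \<in> L" for l
  proof -
    obtain \<sigma> \<gamma> a where *: "(\<sigma>, \<gamma>) \<in> Rt" "a \<in> A" "l = (\<lambda>a'. \<gamma> (a' - a))"
      using l by (auto simp: L_def)
    then have "l a = 1" by (simp add: Rt_def chart_points_def)
    then show ?thesis using *(2) by (intro bexI[of _ a]) auto
  qed
  ultimately obtain t where t: "\<And>l. l \<in> L \<Longrightarrow> (\<Sum>a\<in>A. l a * t ^ idx a) \<noteq> 0"
    using moment_curve_avoids_hyperplanes[OF A(1) idx, of L UNIV] infinite_UNIV_alg_closed_field
    by blast
  define c where "c = (\<lambda>(i, e). append_entry (\<lambda>j. mcoeff (F j) e) (if e \<in> A then t ^ idx e else 0) i)"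
  have "mpoly_eval of_int c R = 0"
    using mpoly_eval_twisted_chow_form[OF A(1), of "\<lambda>a. t ^ idx a" R F] Ch
    by (simp add: c_def mpoly_eval_def)
  moreover obtain p d where vars: "mpoly_vars p \<subseteq> (SIGMA i:UNIV. ?E i)" and prim: "primitive_mpoly p"
    and closure: "{c \<in> coeff_vectors ?E. mpoly_eval of_int c p = 0}
      = zariski_closure_in (coeff_vectors ?E) (solvable_coeffs ?E)"
    and "R = p ^ d \<or> R = - (p ^ d)"
    using assms(10) unfolding is_sparse_resultant_def by (elim exE conjE) (rule that, assumption+)
  \<comment> \<open>The case \<open>d = 0\<close> is contradictory, since \<open>R\<close> would
    then be 1 or -1.\<close>
  ultimately have c0: "mpoly_eval of_int c p = 0"
    by (auto simp: ev_int.power ev_int.uminus)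
  have "c (i, e) = 0" if "e \<notin> ?E i" for i e
  proof (cases i)
    case (Some j)
    then have "e \<notin> msupport (F j)" using assms(4)[of j] that by (auto simp: append_entry_def)
    then show ?thesis using Some by (simp add: c_def append_entry_def in_keys_iff)
  qed (use that in \<open>simp add: c_def append_entry_def\<close>)
  then have c_out: "\<forall>i e. e \<notin> ?E i \<longrightarrow> c (i, e) = 0" by blast
  obtain C and x :: "generic_field ^ 'n" and H where x: "\<forall>k. x $ k \<noteq> 0" and H: "partial_hom H"
    and C: "\<forall>i. (\<Sum>e\<in>?E i. C (i, e) * laurent_monom x e) = 0" "\<forall>v. (C v, c v) \<in> H"
    and total: "\<forall>a. a \<noteq> 0 \<longrightarrow> a \<in> fst ` H \<or> inverse a \<in> fst ` H"
    using ex_specialization_place[of ?E p c, OF E' vars prim closure c_out c0]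
    by (elim exE conjE) (rule that, assumption+)
  obtain \<sigma> \<gamma> where \<sigma>: "\<sigma> \<in> Fan P" and \<gamma>: "\<gamma> \<in> chart_points \<sigma>"
    and place: "\<And>e. e \<in> dual_monoid \<sigma> \<Longrightarrow> (laurent_monom x e, \<gamma> e) \<in> H"
    using ex_chart_point_of_place[of E x H, OF assms(1,2)] x H total unfolding assms(5) by blast
  \<comment> \<open>Each generic equation is multiplied by \<open>x^b\<close>; when all exponents
    \<open>b + e\<close> lie in the dual monoid, its terms are in the domain of the place, which
    carries it to the chart point.\<close>
  have root: "(\<Sum>e\<in>?E i. c (i, e) * \<gamma> (b + e)) = 0" if b: "\<And>e. e \<in> ?E i \<Longrightarrow> b + e \<in> dual_monoid \<sigma>" for i b
  proof -
    have "(\<Sum>e\<in>?E i. C (i, e) * laurent_monom x (b + e)) = laurent_monom x b * (\<Sum>e\<in>?E i. C (i, e) * laurent_monom x e)"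
      using x by (simp add: laurent_monom_add sum_distrib_left mult_ac)
    also have "\<dots> = 0" using C(1) by simp
    finally have "(\<Sum>e\<in>?E i. C (i, e) * laurent_monom x (b + e)) = 0" .
    moreover have "(\<Sum>e\<in>?E i. C (i, e) * laurent_monom x (b + e), \<Sum>e\<in>?E i. c (i, e) * \<gamma> (b + e)) \<in> H"
      using C(2) place b by (intro partial_hom_sum[OF H] partial_hom_mult[OF H]) auto
    ultimately show ?thesis using H by (simp add: partial_hom_def)
  qed
  have "chart_root E F \<sigma> \<gamma>"
    unfolding chart_root_def
  proof (intro allI impI)
    fix i b assume sub: "(\<lambda>q. real_vec b + q) ` Conv (E i) \<subseteq> dual_cone \<sigma>"
    have "b + e \<in> dual_monoid \<sigma>" if "e \<in> ?E (Some i)" for e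
    proof -
      have "real_vec e \<in> Conv (E i)"
        unfolding Conv_def using that by (intro hull_inc) (simp add: append_entry_def)
      then show ?thesis using sub by (auto simp: dual_monoid_def real_vec_add)
    qed
    then have "(\<Sum>e\<in>?E (Some i). c (Some i, e) * \<gamma> (b + e)) = 0" by (rule root)
    then have "(\<Sum>e\<in>E i. mcoeff (F i) e * \<gamma> (b + e)) = 0"
      by (simp add: c_def append_entry_def)
    moreover have "(\<Sum>e\<in>msupport (F i). mcoeff (F i) e * \<gamma> (b + e)) = (\<Sum>e\<in>E i. mcoeff (F i) e * \<gamma> (b + e))"
      using assms(1,4) by (intro sum.mono_neutral_left) (auto simp: in_keys_iff)
    ultimately show "(\<Sum>e\<in>msupport (F i). mcoeff (F i) e * \<gamma> (b + e)) = 0" by simp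
  qed
  then have "(\<sigma>, \<gamma>) \<in> Rt" using \<sigma> \<gamma> by (simp add: Rt_def)
  moreover obtain a where a: "a \<in> A" "\<And>a'. a' \<in> A \<Longrightarrow> a' - a \<in> dual_monoid \<sigma>"
  proof -
    have "\<exists>q. q \<in> Conv (E i)" for i
      unfolding ex_in_conv using assms(2)[of i] by (simp add: Conv_def)
    then obtain q where "\<And>i. q i \<in> Conv (E i)" by metis
    then have "(\<Sum>i\<in>UNIV. q i) \<in> P" unfolding assms(5) set_sum_alt[OF finite] by blast
    then have "P \<noteq> {}" by blast
    then show ?thesis
      using ex_vertex_minimal_on_cone[OF P _ B \<open>B \<noteq> {}\<close> assms(7,8) \<sigma>] that by blast
  qed
  ultimately have "(\<lambda>a'. \<gamma> (a' - a)) \<in> L" by (force simp: L_def)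
  \<comment> \<open>For \<open>b = - a\<close>, the equation of \<open>g\<close> at the specialized
    root contradicts the choice of \<open>t\<close>.\<close>
  from t[OF this] have "(\<Sum>a'\<in>A. c (None, a') * \<gamma> (- a + a')) \<noteq> 0"
    by (simp add: c_def append_entry_def mult.commute)
  moreover have "(\<Sum>a'\<in>?E None. c (None, a') * \<gamma> (- a + a')) = 0"
    using a(2) by (intro root) (simp add: append_entry_def)
  ultimately show False by (simp add: append_entry_def)
qed

end
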